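(* Fix $\varepsilon,\delta,\beta\in(0,1)$ and $r\in\mathbb{N}$. Let $\mathcal{W}$ be an $(\varepsilon,\delta)$-privacy wrapper over a countably infinite universe $\mathcal{U}$ that is $\lambda$-down local and has the following accuracy guarantee: for all $f:\mathcal{U}^*\to\{1,\dots,r\}$ and $x\in\mathcal{U}^*$, $$\Pr\Big[\mathcal{W}^f(x)\in\big[\min f(\mathrm{DN}_\lambda(x)),\max f(\mathrm{DN}_\lambda(x))\big]\Big]\ge1-\beta.$$ Then $\lambda=\Omega(\log^*(r))$.
   Context: $\mathcal{U}^*$ denotes the set of finite subsets of $\mathcal{U}$; $x,y$ are neighbors if one is obtained from the other by inserting one element. $(\varepsilon,\delta)$-DP: for neighbors $x,y$ and measurable $E$, $\Pr[\mathcal{M}(x)\in E]\le e^\varepsilon\Pr[\mathcal{M}(y)\in E]+\delta$. A privacy wrapper is a randomized algorithm $\mathcal{W}$ taking a dataset $x$, possibly parameters, and query access to $f:\mathcal{U}^*\to\mathbb{R}$, outputting in $\mathbb{R}\cup\{\perp\}$; it is an $(\varepsilon,\delta)$-privacy wrapper if $x\mapsto\mathcal{W}^f(x)$ is $(\varepsilon,\delta)$-DP for every $f$ and every parameter choice. $\mathrm{DN}_\lambda(x)=\{z\subseteq x:|x\setminus z|\le\lambda\}$, $f(S)=\{f(z):z\in S\}$; $\lambda$-down local means on input $x$ it queries $f$ only on $\mathrm{DN}_\lambda(x)$. $\log^*$ is the iterated logarithm.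
   Formalization: The added assumption δ + β < 1 is needed: if δ + β ≥ 1, the wrapper that outputs f(x) with probability δ and ⊥ otherwise is (ε,δ)-private, 0-down local and accurate for every r, so λ = 0 while log*(r) is unbounded. *)

theory Defs
  imports "HOL-Probability.Probability" "HOL-Library.FSet"
begin

text \<open>Datasets are the finite subsets of the universe, i.e. elements of \<^typ>\<open>'u fset\<close>.\<close>

definition neighbors :: "'u fset \<Rightarrow> 'u fset \<Rightarrow> bool" where
  "neighbors x y \<longleftrightarrow>
     (\<exists>u. u |\<notin>| x \<and> y = finsert u x) \<or> (\<exists>u. u |\<notin>| y \<and> x = finsert u y)"

definition DN :: "nat \<Rightarrow> 'u fset \<Rightarrow> 'u fset set" where
  "DN l x = {z. z |\<subseteq>| x \<and> fcard (x |-| z) \<le> l}"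

text \<open>Outputs lie in the reals together with a nonresponse symbol, represented by \<^const>\<open>None\<close>.
  A set of outputs is measurable iff its real part is Borel.\<close>

definition output_space :: "real option measure" where
  "output_space = sigma UNIV {E. Some -` E \<in> sets borel}"

lemma space_output_space [simp]: "space output_space = UNIV"
  by (simp add: output_space_def)

lemma sets_output_space: "sets output_space = {E. Some -` E \<in> sets borel}"
proof -
  have "sigma_algebra UNIV {E :: real option set. Some -` E \<in> sets borel}"
    by (auto simp: sigma_algebra_iff2 vimage_Diff vimage_UN)
  then show ?thesis
    by (simp add: output_space_def sigma_algebra.sigma_sets_eq)
qed

text \<open>A deterministic algorithm with query access to \<open>f\<close> is a tree of adaptive queries: each
  query names a dataset and the computation continues according to the answer. Each run makes
  finitely many queries, with no bound on their number.\<close>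

datatype 'u query_tree =
    Answer "real option"
  | Query "'u fset" "real \<Rightarrow> 'u query_tree"

primrec run :: "'u query_tree \<Rightarrow> ('u fset \<Rightarrow> real) \<Rightarrow> real option" where
  "run (Answer a) f = a"
| "run (Query z k) f = run (k (f z)) f"

primrec queried :: "'u query_tree \<Rightarrow> ('u fset \<Rightarrow> real) \<Rightarrow> 'u fset set" where
  "queried (Answer a) f = {}"
| "queried (Query z k) f = insert z (queried (k (f z)) f)"

text \<open>A randomized algorithm assigns to each input dataset a random query tree, i.e. the tree
  that remains once the coins have been fixed. The \<open>\<sigma>\<close>-algebra on trees is arbitrary, subject
  only to the output being a random variable for every oracle \<open>f\<close>. Any further parameters are
  regarded as part of the algorithm.\<close>

type_synonym 'u randomized_alg = "'u fset \<Rightarrow> 'u query_tree measure"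

definition randomized_algorithm :: "'u randomized_alg \<Rightarrow> bool" where
  "randomized_algorithm W \<longleftrightarrow>
     (\<forall>x. prob_space (W x) \<and> (\<forall>f. (\<lambda>t. run t f) \<in> measurable (W x) output_space))"

definition output_dist :: "'u randomized_alg \<Rightarrow> ('u fset \<Rightarrow> real) \<Rightarrow> 'u fset \<Rightarrow> real option measure" where
  "output_dist W f x = distr (W x) output_space (\<lambda>t. run t f)"

definition differentially_private ::
    "real \<Rightarrow> real \<Rightarrow> ('u fset \<Rightarrow> real option measure) \<Rightarrow> bool" where
  "differentially_private \<epsilon> \<delta> M \<longleftrightarrow>
     (\<forall>x y. neighbors x y \<longrightarrow>
        (\<forall>E \<in> sets output_space. measure (M x) E \<le> exp \<epsilon> * measure (M y) E + \<delta>))"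

definition privacy_wrapper :: "real \<Rightarrow> real \<Rightarrow> 'u randomized_alg \<Rightarrow> bool" where
  "privacy_wrapper \<epsilon> \<delta> W \<longleftrightarrow>
     randomized_algorithm W \<and> (\<forall>f. differentially_private \<epsilon> \<delta> (output_dist W f))"

definition down_local :: "nat \<Rightarrow> 'u randomized_alg \<Rightarrow> bool" where
  "down_local l W \<longleftrightarrow> (\<forall>x. AE t in W x. \<forall>f. queried t f \<subseteq> DN l x)"

definition interior_accurate :: "nat \<Rightarrow> real \<Rightarrow> nat \<Rightarrow> 'u randomized_alg \<Rightarrow> bool" where
  "interior_accurate r \<beta> l W \<longleftrightarrow>
     (\<forall>f x. range f \<subseteq> real ` {1..r} \<longrightarrow>
        measure (output_dist W f x) (Some ` {Min (f ` DN l x)..Max (f ` DN l x)}) \<ge> 1 - \<beta>)"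

text \<open>The number of times \<open>log\<^sub>2\<close> must be applied to bring \<open>x\<close> down to at most 1. The first
  iterate that is at most 1 is reached before \<^const>\<open>log\<close> is ever applied to a nonpositive number.\<close>

definition log_star :: "real \<Rightarrow> nat" where
  "log_star x = (LEAST k. (log 2 ^^ k) x \<le> 1)"

lemma log_star_terminates: "\<exists>k. (log 2 ^^ k) x \<le> 1"
proof -
  have "\<exists>k. (log 2 ^^ k) x \<le> 1" if "x \<le> real n" for n
    using that
  proof (induction n arbitrary: x)
    case 0
    then show ?case by (intro exI[of _ 0]) simp
  next
    case (Suc n)
    show ?case
    proof (cases "x \<le> 1")
      case True
      then show ?thesis by (intro exI[of _ 0]) simp
    next
      case gt1: False
      have "log 2 x \<le> real n \<or> log 2 x \<le> 1"
      proof (cases "x \<le> 2")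
        case True
        with gt1 show ?thesis by simp
      next
        case False
        then have "n \<noteq> 0" using Suc.prems by (cases n) auto
        have "x \<le> real (2 ^ n)"
        proof -
          have "Suc n \<le> 2 ^ n" by (simp add: Suc_leI)
          then have "real (Suc n) \<le> real (2 ^ n)" by (rule of_nat_mono)
          with Suc.prems show ?thesis by linarith
        qed
        then have "log 2 x \<le> real n"
          using gt1 by (simp add: log_le_iff powr_realpow)
        then show ?thesis ..
      qed
      then obtain k where "(log 2 ^^ k) (log 2 x) \<le> 1"
      proof
        assume "log 2 x \<le> real n"
        then show ?thesis using Suc.IH that by blast
      next
        assume "log 2 x \<le> 1"
        then show ?thesis using that[of 0] by simp
      qed
      then show ?thesis
        by (intro exI[of _ "Suc k"]) (simp add: funpow_swap1)
    qed
  qed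
  moreover obtain n where "x \<le> real n" using real_arch_simple by blast
  ultimately show ?thesis by blast
qed

lemma log_star_le_1: "x \<le> 1 \<Longrightarrow> log_star x = 0"
  unfolding log_star_def by (rule Least_equality) auto

lemma log_star_gt_1: "x > 1 \<Longrightarrow> log_star x = Suc (log_star (log 2 x))"
proof -
  assume "x > 1"
  obtain k where "(log 2 ^^ k) x \<le> 1" using log_star_terminates by blast
  then have "log_star x = Suc (LEAST m. (log 2 ^^ Suc m) x \<le> 1)"
    unfolding log_star_def by (rule Least_Suc) (use \<open>x > 1\<close> in simp)
  then show ?thesis
    by (simp add: log_star_def funpow_Suc_right del: funpow.simps)
qed

end

theory Submission
  imports Defs
begin

text \<open>Fix a degree \<open>B\<close> of order \<open>\<lambda> + 1\<close> and consider the
  bipartite \<open>B\<close>-regular tree, whose vertices are called nodes and lines. A small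
  dataset is attached to a line and \<open>B\<close> datasets, each with one more element, are
  attached to the nodes of that line. Numbers are placed on the tree in \<open>2 * \<lambda>\<close>
  stages: at stage \<open>k + 1\<close> they are base-\<open>B\<close> strings, and two neighbours
  of a vertex \<open>q\<close> agree exactly on as many leading digits as the number of
  \<open>q\<close> at stage \<open>k\<close> says. This costs one exponential per stage, so all
  numbers lie below a tower of height \<open>2 * \<lambda>\<close>. The oracle answers with numbers
  of the last stage, arranged so that on the dataset of a node it only reveals those within distance
  \<open>2 * \<lambda>\<close>.

  An output in the range of these answers can be pulled back stage by stage, by counting the digits
  on which it agrees with the centre. Either this ends at the stage-0 number of the node, or on the
  way the output agrees with some vertex beyond the branching point, and so singles it out. At a
  branching over a node an output can single out one of the \<open>B\<close> lines only; if the
  strings and the names of the data elements are random, the line at hand is singled out with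
  probability at most \<open>\<lambda> / B\<close>. At a branching over the line it can single out
  one node only, and pulling back to stage 0 also determines one node; so the outputs on the small
  dataset favour at most \<open>\<lambda> + 1\<close> of the \<open>B\<close> nodes. A single
  comparison of neighbouring datasets, hence an arbitrary constant \<open>\<delta> < 1 -
  \<beta>\<close>, makes the two bounds contradictory.\<close>

section \<open>Agreement of digit strings\<close>

text \<open>Counts common leading base-\<open>B\<close> digits of strings of length
  \<open>L\<close>; dropping the last digit is division by \<open>B\<close>. Arguments may exceed
  \<open>B ^ L\<close>, as arbitrary outputs do, and then share no leading digit with a number below
  \<open>B ^ L\<close>.\<close>

fun agree :: "nat \<Rightarrow> nat \<Rightarrow> nat \<Rightarrow> nat \<Rightarrow> nat" where
  "agree B 0 x y = 0"
| "agree B (Suc L) x y = (if x = y then Suc L else agree B L (x div B) (y div B))"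

lemma agree_le: "agree B L x y \<le> L"
  by (induction L arbitrary: x y) (auto intro: le_SucI)

lemma agree_refl [simp]: "agree B L x x = L"
  by (cases L) auto

lemma agree_sym: "agree B L x y = agree B L y x"
  by (induction L arbitrary: x y) auto

lemma agree_ultra: "min (agree B L x y) (agree B L y z) \<le> agree B L x z"
proof (induction L arbitrary: x y z)
  case (Suc L)
  show ?case
    using Suc.IH[of "x div B" "y div B" "z div B"] agree_le[of B L] by (auto intro: le_SucI)
qed simp

text \<open>Division by \<open>B\<close> is monotone, so a prefix common to the endpoints is shared
  by everything between them. This is where the order of the outputs meets the ultrametric.\<close>

lemma agree_between:
  assumes "x \<le> w" "w \<le> y"
  shows "agree B L x y \<le> agree B L x w" "agree B L x y \<le> agree B L w y"
proof -
  have "agree B L x y \<le> agree B L x w \<and> agree B L x y \<le> agree B L w y"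
    using assms
  proof (induction L arbitrary: x w y)
    case (Suc L)
    then show ?case
      using Suc.IH[of "x div B" "w div B" "y div B"] agree_le[of B L "x div B" "y div B"]
      by (auto simp: div_le_mono intro: le_SucI)
  qed simp
  then show "agree B L x y \<le> agree B L x w" "agree B L x y \<le> agree B L w y" by auto
qed

lemma agree_eq_length_iff:
  assumes "x < B ^ L" "y < B ^ L"
  shows "agree B L x y = L \<longleftrightarrow> x = y"
proof (cases L)
  case 0
  then show ?thesis using assms by simp
next
  case (Suc L')
  then show ?thesis using agree_le[of B L' "x div B" "y div B"] by auto
qed

lemma agree_isosceles:
  assumes "agree B L x m \<noteq> agree B L m y"
  shows "agree B L x y = min (agree B L x m) (agree B L m y)"
  using assms agree_ultra[of B L x m y] agree_ultra[of B L x y m] agree_ultra[of B L m x y]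
    agree_sym[of B L x m] agree_sym[of B L y m] by linarith

text \<open>Up to the prefix shared by \<open>x\<close> and \<open>y\<close>, comparing with one is
  comparing with the other. The pullbacks use this to exchange reference vertices.\<close>

lemma agree_cap_cong:
  "min (agree B L w x) (agree B L x y) = min (agree B L w y) (agree B L x y)"
  using agree_ultra[of B L w x y] agree_ultra[of B L w y x] agree_sym[of B L x y] by linarith

text \<open>Hence of several points that pairwise agree in exactly \<open>t\<close> digits, at most
  one can be singled out by \<open>w\<close>.\<close>

lemma agree_above_unique:
  assumes "t < agree B L w x" "t < agree B L w y"
  shows "t < agree B L x y"
  using assms agree_ultra[of B L x w y] agree_sym[of B L w x] by linarith

section \<open>Isometries of the space of digit strings\<close>

definition agree_perms :: "nat \<Rightarrow> nat \<Rightarrow> (nat \<Rightarrow> nat) set" where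
  "agree_perms B L = {\<alpha>. \<alpha> permutes {..<B ^ L} \<and>
     (\<forall>x<B ^ L. \<forall>y<B ^ L. agree B L (\<alpha> x) (\<alpha> y) = agree B L x y)}"

lemma finite_agree_perms: "finite (agree_perms B L)"
  by (rule finite_subset[OF _ finite_permutations[of "{..<B ^ L}"]]) (auto simp: agree_perms_def)

lemma id_in_agree_perms: "id \<in> agree_perms B L"
  by (auto simp: agree_perms_def permutes_id)

lemma agree_perms_less: "\<alpha> \<in> agree_perms B L \<Longrightarrow> x < B ^ L \<Longrightarrow> \<alpha> x < B ^ L"
  using permutes_in_image[of \<alpha> "{..<B ^ L}" x] by (auto simp: agree_perms_def)

lemma agree_perms_comp:
  assumes "\<alpha> \<in> agree_perms B L" "\<beta> \<in> agree_perms B L"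
  shows "\<alpha> \<circ> \<beta> \<in> agree_perms B L"
  using assms agree_perms_less[OF assms(2)] by (auto simp: agree_perms_def permutes_compose)

lemma bij_betw_comp_agree_perms:
  assumes "\<beta> \<in> agree_perms B L"
  shows "bij_betw (\<lambda>\<alpha>. \<alpha> \<circ> \<beta>) (agree_perms B L) (agree_perms B L)"
proof -
  have "surj \<beta>" using assms by (auto simp: agree_perms_def dest: permutes_surj)
  then have inj: "inj_on (\<lambda>\<alpha>. \<alpha> \<circ> \<beta>) (agree_perms B L)"
    by (intro inj_onI) (metis comp_apply ext surjD)
  have "(\<lambda>\<alpha>. \<alpha> \<circ> \<beta>) ` agree_perms B L \<subseteq> agree_perms B L"
    using assms agree_perms_comp by auto
  then have "(\<lambda>\<alpha>. \<alpha> \<circ> \<beta>) ` agree_perms B L = agree_perms B L"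
    by (intro endo_inj_surj finite_agree_perms inj)
  with inj show ?thesis by (simp add: bij_betw_def)
qed

text \<open>The base-\<open>B\<close> strings of a given length form a homogeneous ultrametric space.\<close>

lemma agree_perms_extend:
  assumes B: "0 < B"
    and "\<And>p. p \<in> D \<Longrightarrow> x p < B ^ L" "\<And>p. p \<in> D \<Longrightarrow> y p < B ^ L"
    and "\<And>p q. p \<in> D \<Longrightarrow> q \<in> D \<Longrightarrow> agree B L (x p) (x q) = agree B L (y p) (y q)"
  shows "\<exists>\<alpha>\<in>agree_perms B L. \<forall>p\<in>D. \<alpha> (x p) = y p"
  using assms(2-)
proof (induction L arbitrary: x y)
  case 0
  then show ?case by (intro bexI[of _ id]) (auto simp: id_in_agree_perms)
next
  case (Suc L)
  have lt: "x p div B < B ^ L" "y p div B < B ^ L" if "p \<in> D" for p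
    using Suc.prems(1,2)[OF that] B by (simp_all add: less_mult_imp_div_less mult.commute)
  have ag: "agree B L (x p div B) (x q div B) = agree B L (y p div B) (y q div B)"
    if "p \<in> D" "q \<in> D" for p q
    using Suc.prems(3)[OF that] agree_le[of B L "x p div B" "x q div B"]
      agree_le[of B L "y p div B" "y q div B"] by (auto split: if_splits)
  have eq_iff: "x p = x q \<longleftrightarrow> y p = y q" if "p \<in> D" "q \<in> D" for p q
    using agree_eq_length_iff[of "x p" B "Suc L" "x q"] agree_eq_length_iff[of "y p" B "Suc L" "y q"]
      Suc.prems that by metis
  \<comment> \<open>The induction hypothesis treats the prefixes. Below each prefix \<open>c\<close>
    a separate permutation \<open>t c\<close> of the last digit then extends the prescribed
    values.\<close>
  obtain \<alpha> where \<alpha>: "\<alpha> \<in> agree_perms B L" "\<And>p. p \<in> D \<Longrightarrow> \<alpha> (x p div B) = y p div B"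
    using Suc.IH[of "\<lambda>p. x p div B" "\<lambda>p. y p div B"] lt ag by blast
  have "\<exists>t. t permutes {..<B} \<and> (\<forall>p\<in>D. x p div B = c \<longrightarrow> t (x p mod B) = y p mod B)" for c
  proof -
    define P where "P = {p \<in> D. x p div B = c}"
    have ydiv: "y p div B = \<alpha> c" if "p \<in> P" for p
      using \<alpha>(2)[of p] that by (auto simp: P_def)
    have xy: "x p mod B = x q mod B \<longleftrightarrow> y p mod B = y q mod B" if "p \<in> P" "q \<in> P" for p q
    proof -
      have mod_iff: "a mod B = b mod B \<longleftrightarrow> a = b" if "a div B = b div B" for a b :: nat
        using that by (metis div_mult_mod_eq)
      have "x p mod B = x q mod B \<longleftrightarrow> x p = x q"
        using that by (intro mod_iff) (simp add: P_def)
      moreover have "y p mod B = y q mod B \<longleftrightarrow> y p = y q"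
        using ydiv[OF that(1)] ydiv[OF that(2)] by (intro mod_iff) simp
      ultimately show ?thesis using eq_iff[of p q] that by (auto simp: P_def)
    qed
    define m where "m a = y (SOME p. p \<in> P \<and> x p mod B = a) mod B" for a
    have m: "m (x p mod B) = y p mod B" if "p \<in> P" for p
    proof -
      define q where "q = (SOME q. q \<in> P \<and> x q mod B = x p mod B)"
      have "q \<in> P \<and> x q mod B = x p mod B"
        unfolding q_def by (rule someI[of _ p]) (use that in auto)
      then have "y q mod B = y p mod B" using xy[of q p] that by simp
      then show ?thesis by (simp add: m_def q_def)
    qed
    let ?A = "(\<lambda>p. x p mod B) ` P"
    have sub: "?A \<subseteq> {..<B}" "m ` ?A \<subseteq> {..<B}" using B by (auto simp: m)
    have injm: "inj_on m ?A" by (auto simp: inj_on_def m xy)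
    have fin: "finite ?A" "finite (m ` ?A)" using sub by (meson finite_lessThan finite_subset)+
    have "card ({..<B} - ?A) = card ({..<B} - m ` ?A)"
      using sub fin by (simp add: card_Diff_subset card_image[OF injm])
    then obtain g where g: "bij_betw g ({..<B} - ?A) ({..<B} - m ` ?A)"
      by (meson finite_Diff finite_lessThan finite_same_card_bij)
    define t where "t a = (if a \<in> ?A then m a else if a < B then g a else a)" for a
    have "bij_betw t ?A (m ` ?A)"
      using injm by (auto simp: t_def bij_betw_def inj_on_def)
    moreover have "bij_betw t ({..<B} - ?A) ({..<B} - m ` ?A)"
      using g by (rule iffD1[OF bij_betw_cong, rotated]) (auto simp: t_def)
    ultimately have "bij_betw t (?A \<union> ({..<B} - ?A)) (m ` ?A \<union> ({..<B} - m ` ?A))"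
      by (rule bij_betw_combine) auto
    then have "bij_betw t {..<B} {..<B}"
      using sub by (simp add: Un_absorb1)
    then have "t permutes {..<B}"
      by (rule bij_imp_permutes) (use sub in \<open>auto simp: t_def\<close>)
    moreover have "t (x p mod B) = y p mod B" if "p \<in> D" "x p div B = c" for p
      using m[of p] that by (auto simp: t_def P_def)
    ultimately show ?thesis by blast
  qed
  then obtain t where t: "\<And>c. t c permutes {..<B}"
    "\<And>p. p \<in> D \<Longrightarrow> t (x p div B) (x p mod B) = y p mod B" by metis
  have tlt: "t c a < B" if "a < B" for c a
    using permutes_in_image[OF t(1), of c a] that by simp
  define \<gamma> where "\<gamma> z = (if z < B ^ Suc L then B * \<alpha> (z div B) + t (z div B) (z mod B) else z)" for z
  have div\<gamma>: "\<gamma> z div B = \<alpha> (z div B)" and mod\<gamma>: "\<gamma> z mod B = t (z div B) (z mod B)"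
    if "z < B ^ Suc L" for z
    using that B tlt[of "z mod B"] by (simp_all add: \<gamma>_def)
  have divlt: "z div B < B ^ L" if "z < B ^ Suc L" for z
    using that by (simp add: less_mult_imp_div_less mult.commute)
  have \<gamma>lt: "\<gamma> z < B ^ Suc L" if "z < B ^ Suc L" for z
  proof -
    have "\<gamma> z div B < B ^ L" using div\<gamma>[OF that] agree_perms_less[OF \<alpha>(1) divlt[OF that]] by simp
    then show ?thesis using B by (simp add: div_less_iff_less_mult mult.commute)
  qed
  have inj\<alpha>: "inj \<alpha>" using \<alpha>(1) by (auto simp: agree_perms_def dest: permutes_inj)
  have \<gamma>eq: "\<gamma> z = \<gamma> z' \<longleftrightarrow> z = z'" if "z < B ^ Suc L" "z' < B ^ Suc L" for z z'
  proof
    assume eq: "\<gamma> z = \<gamma> z'"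
    then have "\<alpha> (z div B) = \<alpha> (z' div B)" using div\<gamma> that by metis
    then have d: "z div B = z' div B" using inj\<alpha> by (simp add: inj_eq)
    have "t (z div B) (z mod B) = t (z div B) (z' mod B)" using eq mod\<gamma> that d by metis
    then have "z mod B = z' mod B" using permutes_inj[OF t(1)] by (simp add: inj_eq)
    with d show "z = z'" by (metis div_mult_mod_eq)
  qed simp
  have "bij_betw \<gamma> {..<B ^ Suc L} {..<B ^ Suc L}"
  proof -
    have "inj_on \<gamma> {..<B ^ Suc L}" using \<gamma>eq by (auto simp: inj_on_def)
    moreover have "\<gamma> ` {..<B ^ Suc L} \<subseteq> {..<B ^ Suc L}" using \<gamma>lt by auto
    ultimately show ?thesis by (simp add: bij_betw_def endo_inj_surj)
  qed
  then have "\<gamma> permutes {..<B ^ Suc L}"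
    by (rule bij_imp_permutes) (auto simp: \<gamma>_def)
  moreover have "agree B (Suc L) (\<gamma> z) (\<gamma> z') = agree B (Suc L) z z'"
    if "z < B ^ Suc L" "z' < B ^ Suc L" for z z'
    using \<gamma>eq[OF that] div\<gamma> that \<alpha>(1) divlt[OF that(1)] divlt[OF that(2)]
    by (auto simp: agree_perms_def)
  ultimately have "\<gamma> \<in> agree_perms B (Suc L)"
    unfolding agree_perms_def by blast
  moreover have "\<gamma> (x p) = y p" if "p \<in> D" for p
    using Suc.prems(1)[OF that] div\<gamma>[of "x p"] mod\<gamma>[of "x p"] \<alpha>(2)[OF that] t(2)[OF that]
    by (metis div_mult_mod_eq)
  ultimately show ?case by blast
qed

text \<open>The members differ from \<open>x\<close> only in the digit after the first
  \<open>t\<close>, where each index gets its own digit; a transposition puts \<open>x\<close> at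
  index \<open>a\<close>.\<close>

lemma agree_fan:
  assumes B: "0 < B" and "a < B" "x < B ^ L" "t < L"
  shows "\<exists>y. y a = x \<and> (\<forall>i<B. y i < B ^ L) \<and>
           (\<forall>i<B. \<forall>i'<B. i \<noteq> i' \<longrightarrow> agree B L (y i) (y i') = t)"
  using assms(3,4)
proof (induction L arbitrary: x)
  case (Suc L)
  have lt: "x div B < B ^ L" using Suc.prems(1) by (simp add: less_mult_imp_div_less mult.commute)
  have up: "B * c + d < B ^ Suc L" if "c < B ^ L" "d < B" for c d
  proof -
    have "B * c + d < B * Suc c" using that by simp
    also have "\<dots> \<le> B * B ^ L" using that by (intro mult_le_mono2) simp
    finally show ?thesis by simp
  qed
  show ?case
  proof (cases "t = L")
    case True
    define s where "s = (Transposition.transpose a (x mod B) :: nat \<Rightarrow> nat)"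
    have s: "s i < B" if "i < B" for i using that B assms(2) by (auto simp: s_def Transposition.transpose_def)
    have inj: "s i = s i' \<longleftrightarrow> i = i'" for i i' by (auto simp: s_def transpose_eq_iff)
    define y where "y i = B * (x div B) + s i" for i
    have "y a = x" by (simp add: y_def s_def)
    moreover have "y i < B ^ Suc L" if "i < B" for i
      unfolding y_def using up[OF lt s[OF that]] .
    moreover have "agree B (Suc L) (y i) (y i') = t" if "i < B" "i' < B" "i \<noteq> i'" for i i'
      using that s[of i] s[of i'] inj True by (simp add: y_def)
    ultimately show ?thesis by blast
  next
    case False
    then have "t < L" using Suc.prems(2) by simp
    then obtain u where u: "u a = x div B" "\<And>i. i < B \<Longrightarrow> u i < B ^ L"
      "\<And>i i'. i < B \<Longrightarrow> i' < B \<Longrightarrow> i \<noteq> i' \<Longrightarrow> agree B L (u i) (u i') = t"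
      using Suc.IH[OF lt] by blast
    define y where "y i = B * u i + x mod B" for i
    have "y a = x" by (simp add: y_def u)
    moreover have "y i < B ^ Suc L" if "i < B" for i
      unfolding y_def using up[OF u(2)[OF that], of "x mod B"] B by simp
    moreover have "agree B (Suc L) (y i) (y i') = t" if "i < B" "i' < B" "i \<noteq> i'" for i i'
    proof -
      have "u i \<noteq> u i'" using u(3)[OF that] \<open>t < L\<close> by auto
      then show ?thesis using u(3)[OF that] B by (simp add: y_def)
    qed
    ultimately show ?thesis by blast
  qed
qed simp

section \<open>The regular tree\<close>

text \<open>Vertices are words without equal adjacent letters, i.e. the elements of a free product of
  \<open>B\<close> groups of order two, on which the letters act from the left. Even length means line, odd
  length means node; the small dataset belongs to the line \<open>[]\<close>, with nodes \<open>[j]\<close>.\<close>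

definition flip :: "nat \<Rightarrow> nat list \<Rightarrow> nat list" where
  "flip i p = (case p of [] \<Rightarrow> [i] | a # q \<Rightarrow> if a = i then q else i # p)"

definition verts :: "nat \<Rightarrow> nat list set" where
  "verts B = {p. set p \<subseteq> {..<B} \<and> distinct_adj p}"

definition nbrs :: "nat \<Rightarrow> nat list \<Rightarrow> nat list set" where
  "nbrs B p = (\<lambda>i. flip i p) ` {..<B}"

lemma flip_Nil [simp]: "flip i [] = [i]"
  by (simp add: flip_def)

lemma flip_Cons [simp]: "flip i (a # q) = (if a = i then q else i # a # q)"
  by (simp add: flip_def)

lemma Nil_in_verts [simp]: "[] \<in> verts B"
  by (simp add: verts_def)

lemma singleton_in_verts [simp]: "[j] \<in> verts B \<longleftrightarrow> j < B"
  by (simp add: verts_def)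

lemma Cons_in_vertsD: "a # q \<in> verts B \<Longrightarrow> a < B \<and> q \<in> verts B"
  by (cases q) (auto simp: verts_def)

lemma tl_in_verts: "p \<in> verts B \<Longrightarrow> tl p \<in> verts B"
  by (cases p) (auto dest: Cons_in_vertsD)

lemma flip_in_verts: "p \<in> verts B \<Longrightarrow> i < B \<Longrightarrow> flip i p \<in> verts B"
  by (cases p; cases "tl p") (auto simp: verts_def)

lemma flip_flip: "p \<in> verts B \<Longrightarrow> flip i (flip i p) = p"
  by (cases p; cases "tl p") (auto simp: verts_def)

lemma flip_eq_iff: "flip i p = flip i' p \<longleftrightarrow> i = i'"
  by (cases p) (auto dest: arg_cong[of _ _ length])

lemma even_length_flip [simp]: "even (length (flip i p)) \<longleftrightarrow> odd (length p)"
  by (cases p) auto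

lemma nbrs_sym: "p \<in> verts B \<Longrightarrow> q \<in> nbrs B p \<Longrightarrow> p \<in> nbrs B q"
  by (force simp: nbrs_def flip_flip)

lemma nbrs_subset_verts: "p \<in> verts B \<Longrightarrow> nbrs B p \<subseteq> verts B"
  by (auto simp: nbrs_def flip_in_verts)

lemma finite_nbrs [simp]: "finite (nbrs B p)"
  by (simp add: nbrs_def)

lemma tl_in_nbrs: "p \<in> verts B \<Longrightarrow> p \<noteq> [] \<Longrightarrow> tl p \<in> nbrs B p"
  by (cases p) (auto simp: nbrs_def image_iff dest!: Cons_in_vertsD intro!: bexI[of _ "hd p"])

text \<open>Endpoints of walks of exactly \<open>k\<close> steps. As walks may backtrack, for a
  vertex \<open>p\<close> and \<open>0 < B\<close> these are the vertices at distance at most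
  \<open>k\<close> with the parity of \<open>k\<close>: only nodes or only lines.\<close>

primrec tree_ball :: "nat \<Rightarrow> nat list \<Rightarrow> nat \<Rightarrow> nat list set" where
  "tree_ball B p 0 = {p}"
| "tree_ball B p (Suc k) = (\<Union>q\<in>tree_ball B p k. nbrs B q)"

lemma ball_subset_verts: "p \<in> verts B \<Longrightarrow> tree_ball B p k \<subseteq> verts B"
  by (induction k) (use nbrs_subset_verts in auto)

lemma finite_ball [simp]: "finite (tree_ball B p k)"
  by (induction k) auto

lemma even_length_ball: "q \<in> tree_ball B p k \<Longrightarrow> even (length q) \<longleftrightarrow> even (length p + k)"
  by (induction k arbitrary: q) (auto simp: nbrs_def)

lemma ball_Suc_right: "tree_ball B p (Suc k) = (\<Union>q\<in>nbrs B p. tree_ball B q k)"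
  by (induction k) auto

lemma ball_subset_add_2:
  assumes "p \<in> verts B" "0 < B"
  shows "tree_ball B p k \<subseteq> tree_ball B p (Suc (Suc k))"
proof
  fix q assume q: "q \<in> tree_ball B p k"
  then have "q \<in> verts B" using ball_subset_verts assms by blast
  moreover have "flip 0 q \<in> nbrs B q" using assms by (auto simp: nbrs_def)
  ultimately show "q \<in> tree_ball B p (Suc (Suc k))" 
    using q nbrs_sym[of q B "flip 0 q"] by auto
qed

lemma ball_mono:
  assumes "p \<in> verts B" "0 < B" "k \<le> k'" "even (k' - k)"
  shows "tree_ball B p k \<subseteq> tree_ball B p k'"
proof -
  obtain m where m: "k' = k + 2 * m" using assms by (metis dvdE le_add_diff_inverse)
  have "tree_ball B p k \<subseteq> tree_ball B p (k + 2 * m)"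
  proof (induction m)
    case (Suc m)
    then show ?case using ball_subset_add_2[OF assms(1,2), of "k + 2 * m"] by simp
  qed simp
  then show ?thesis by (simp add: m)
qed

text \<open>Words shorten towards the root \<open>[]\<close>, while the ball is centred at
  \<open>[j]\<close>. Closure under two steps towards the root lets the pivots in the ball be peeled
  off longest first.\<close>

lemma tl_tl_in_ball:
  assumes "j < B" "q \<in> tree_ball B [j] k" "2 \<le> length q"
  shows "tl (tl q) \<in> tree_ball B [j] k"
  using assms(2,3)
proof (induction k arbitrary: q)
  case (Suc k)
  then obtain p i where p: "p \<in> tree_ball B [j] k" "i < B" "q = flip i p" by (auto simp: nbrs_def)
  have pv: "p \<in> verts B" using p(1) ball_subset_verts[of "[j]" B k] assms(1) by auto
  show ?case
  proof (cases "q = i # p")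
    case True
    then have "tl (tl q) \<in> nbrs B p" using Suc.prems pv by (auto intro!: tl_in_nbrs)
    then show ?thesis using p(1) by auto
  next
    case False
    then have pq: "p = i # q" using p(3) by (cases p) (auto split: if_splits)
    then have "tl q \<in> tree_ball B [j] k" using Suc.IH[OF p(1)] Suc.prems by simp
    moreover have "tl q \<in> verts B" using pv pq Cons_in_vertsD tl_in_verts by blast
    moreover have "tl q \<noteq> []" using Suc.prems(2) by (cases q) auto
    ultimately show ?thesis using tl_in_nbrs[of "tl q" B] by auto
  qed
qed simp

section \<open>Valuations with prescribed agreements around each pivot\<close>

definition compatible ::
    "nat \<Rightarrow> nat \<Rightarrow> (nat list \<Rightarrow> nat) \<Rightarrow> (nat list \<Rightarrow> nat) \<Rightarrow> nat list set \<Rightarrow> bool" where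
  "compatible B L u v Q \<longleftrightarrow> (\<forall>q\<in>Q. \<forall>p\<in>nbrs B q. \<forall>p'\<in>nbrs B q. p \<noteq> p' \<longrightarrow>
     agree B L (u p) (u p') = v q)"

lemma compatible_nbrs:
  assumes "compatible B L u v Q" "q \<in> Q" "p \<in> nbrs B q" "p' \<in> nbrs B q" "p \<noteq> p'"
  shows "agree B L (u p) (u p') = v q"
  using assms by (auto simp: compatible_def)

lemma compatible_subset: "compatible B L u v Q \<Longrightarrow> Q' \<subseteq> Q \<Longrightarrow> compatible B L u v Q'"
  by (auto simp: compatible_def)

text \<open>The agreement of two values is the minimum of \<open>v\<close> over the pivots between them: as \<open>v\<close> is
  injective, the ultrametric inequality is never applied with a tie.\<close>

lemma agree_determined:
  assumes "finite Q" "Q \<subseteq> verts B" "\<And>q. q \<in> Q \<Longrightarrow> even (length q) = b"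
    and "\<And>q. q \<in> Q \<Longrightarrow> 2 \<le> length q \<Longrightarrow> tl (tl q) \<in> Q"
    and "inj_on v Q" "compatible B L u v Q" "compatible B L w v Q"
    and "p \<in> (\<Union>q\<in>Q. nbrs B q)" "p' \<in> (\<Union>q\<in>Q. nbrs B q)" "p \<noteq> p'"
  shows "agree B L (u p) (u p') = agree B L (w p) (w p') \<and> agree B L (u p) (u p') \<in> v ` Q"
  using assms
proof (induction "card Q" arbitrary: Q p p' rule: less_induct)
  case less
  have "Q \<noteq> {}" using less.prems by auto
  \<comment> \<open>A longest pivot \<open>q\<close> is removed. Its neighbour \<open>m\<close>
    towards the root also belongs to a remaining pivot, so all comparisons across pass through
    \<open>m\<close>.\<close>
  have "Max (length ` Q) \<in> length ` Q" using less.prems(1) \<open>Q \<noteq> {}\<close> by (intro Max_in) auto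
  then obtain q where q0: "q \<in> Q" "length q = Max (length ` Q)" by auto
  have q: "q \<in> Q" "\<And>q'. q' \<in> Q \<Longrightarrow> length q' \<le> length q"
    using q0 less.prems(1) by simp_all
  let ?Q = "Q - {q}"
  have same: "agree B L (u x) (u y) = agree B L (w x) (w y) \<and> agree B L (u x) (u y) \<in> v ` Q"
    if "x \<in> nbrs B q" "y \<in> nbrs B q" "x \<noteq> y" for x y
    using compatible_nbrs[OF less.prems(6) q(1) that] compatible_nbrs[OF less.prems(7) q(1) that] q(1)
    by auto
  show ?case
  proof (cases "?Q = {}")
    case True
    then have "Q = {q}" using q by auto
    then have "p \<in> nbrs B q" "p' \<in> nbrs B q" using less.prems(8,9) by auto
    then show ?thesis using same less.prems(10) by blast
  next
    case False
    have IH: "agree B L (u x) (u y) = agree B L (w x) (w y) \<and> agree B L (u x) (u y) \<in> v ` ?Q"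
      if "x \<in> (\<Union>q\<in>?Q. nbrs B q)" "y \<in> (\<Union>q\<in>?Q. nbrs B q)" "x \<noteq> y" for x y
    proof (rule less.hyps)
      show "card ?Q < card Q" using q less.prems(1) by (meson card_Diff1_less)
      show "tl (tl a) \<in> ?Q" if "a \<in> ?Q" "2 \<le> length a" for a
      proof -
        have "length (tl (tl a)) < length a" using that by (cases a) auto
        then show ?thesis using less.prems(4)[of a] q(2)[of a] that by auto
      qed
      show "inj_on v ?Q" using less.prems(5) by (rule inj_on_subset) auto
      show "compatible B L u v ?Q" "compatible B L w v ?Q"
        using less.prems(6,7) compatible_subset[of B L _ v Q ?Q] by auto
    qed (use less.prems that in auto)
    have "q \<noteq> []"
    proof
      assume "q = []"
      then have "Q \<subseteq> {[]}" using q by auto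
      then show False using False \<open>q = []\<close> by auto
    qed
    define m where "m = tl q"
    have qv: "q \<in> verts B" using q less.prems(2) by auto
    have mq: "m \<in> nbrs B q" unfolding m_def by (rule tl_in_nbrs[OF qv \<open>q \<noteq> []\<close>])
    have mv: "m \<in> verts B" unfolding m_def by (rule tl_in_verts[OF qv])
    have mQ: "m \<in> (\<Union>q\<in>?Q. nbrs B q)"
    proof (cases "2 \<le> length q")
      case True
      then have tt: "tl (tl q) \<in> ?Q"
        using less.prems(4)[OF q(1)] by (cases q) (auto dest: arg_cong[of _ _ length])
      have "m \<noteq> []" using True by (cases q) (auto simp: m_def)
      then have "m \<in> nbrs B (tl (tl q))"
        using tl_in_nbrs[OF mv] nbrs_sym[OF mv] by (simp add: m_def)
      then show ?thesis using tt by blast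
    next
      case short: False
      \<comment> \<open>Here \<open>q\<close> has length 1, hence by parity so has every pivot, and
        the root is a neighbour of them all.\<close>
      then have m: "m = []" using \<open>q \<noteq> []\<close> by (cases q; cases "tl q") (auto simp: m_def)
      obtain q' where q': "q' \<in> ?Q" using False by blast
      have "even (length q') = even (length q)" using less.prems(3)[OF q(1)] less.prems(3)[of q'] q' by simp
      moreover have "length q = 1" using short \<open>q \<noteq> []\<close> by (cases q; cases "tl q") auto
      moreover from this have "length q' \<le> 1" using q(2)[of q'] q' by simp
      ultimately have "length q' = 1" by (cases q') auto
      then have "tl q' = []" "q' \<noteq> []" by (cases q'; simp)+
      then show ?thesis using tl_in_nbrs[of q' B] q' less.prems(2) m by auto
    qed
    have cross: "agree B L (u x) (u y) = agree B L (w x) (w y) \<and> agree B L (u x) (u y) \<in> v ` Q"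
      if x: "x \<in> nbrs B q" and y: "y \<in> (\<Union>q\<in>?Q. nbrs B q)" and "x \<noteq> y" for x y
    proof (cases "x = m \<or> y = m")
      case True
      then show ?thesis using IH[of x y] IH[of y x] same[of x y] mq mQ that by blast
    next
      case False
      have xm: "agree B L (u x) (u m) = v q" "agree B L (w x) (w m) = v q"
        using compatible_nbrs[OF less.prems(6) q(1) x mq] compatible_nbrs[OF less.prems(7) q(1) x mq]
          False by auto
      have my: "agree B L (u m) (u y) = agree B L (w m) (w y)" "agree B L (u m) (u y) \<in> v ` ?Q"
        using IH[OF mQ y] False by auto
      then have "v q \<noteq> agree B L (u m) (u y)"
        using less.prems(5) q(1) by (auto simp: inj_on_def)
      then have "agree B L (u x) (u y) = min (v q) (agree B L (u m) (u y))"
        "agree B L (w x) (w y) = min (v q) (agree B L (u m) (u y))"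
        using agree_isosceles[of B L "u x" "u m" "u y"] agree_isosceles[of B L "w x" "w m" "w y"] xm my(1)
        by simp_all
      then show ?thesis using my(2) q(1) by (auto simp: min_def)
    qed
    have split: "(\<Union>q\<in>Q. nbrs B q) = nbrs B q \<union> (\<Union>q\<in>?Q. nbrs B q)" using q(1) by auto
    consider "p \<in> nbrs B q" "p' \<in> nbrs B q" | "p \<in> nbrs B q" "p' \<in> (\<Union>q\<in>?Q. nbrs B q)"
      | "p \<in> (\<Union>q\<in>?Q. nbrs B q)" "p' \<in> nbrs B q" | "p \<in> (\<Union>q\<in>?Q. nbrs B q)" "p' \<in> (\<Union>q\<in>?Q. nbrs B q)"
      using less.prems(8,9) unfolding split by blast
    then show ?thesis
    proof cases
      case 3
      then show ?thesis using cross[of p' p] less.prems(10) by (metis agree_sym)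
    next
      case 4
      then show ?thesis using IH[of p p'] less.prems(10) by blast
    next
      case 1
      then show ?thesis by (rule same) (rule less.prems(10))
    next
      case 2
      then show ?thesis by (rule cross) (rule less.prems(10))
    qed
  qed
qed

lemma agree_determined_ball:
  assumes "j < B" "inj_on v (tree_ball B [j] k)" "compatible B L u v (tree_ball B [j] k)"
    "compatible B L w v (tree_ball B [j] k)" "p \<in> tree_ball B [j] (Suc k)" "p' \<in> tree_ball B [j] (Suc k)" "p \<noteq> p'"
  shows "agree B L (u p) (u p') = agree B L (w p) (w p')"
    and "agree B L (u p) (u p') \<in> v ` tree_ball B [j] k"
proof -
  have "agree B L (u p) (u p') = agree B L (w p) (w p') \<and> agree B L (u p) (u p') \<in> v ` tree_ball B [j] k"
  proof (rule agree_determined[where b = "odd k"])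
    show "tree_ball B [j] k \<subseteq> verts B" using ball_subset_verts[of "[j]" B k] assms(1) by simp
    show "even (length q) = odd k" if "q \<in> tree_ball B [j] k" for q
      using even_length_ball[OF that] by simp
    show "tl (tl q) \<in> tree_ball B [j] k" if "q \<in> tree_ball B [j] k" "2 \<le> length q" for q
      by (rule tl_tl_in_ball[OF assms(1) that])
  qed (use assms in simp_all)
  then show "agree B L (u p) (u p') = agree B L (w p) (w p')"
    "agree B L (u p) (u p') \<in> v ` tree_ball B [j] k" by blast+
qed

definition fan :: "nat \<Rightarrow> nat \<Rightarrow> nat \<Rightarrow> nat \<Rightarrow> nat \<Rightarrow> nat \<Rightarrow> nat" where
  "fan B L x t a = (SOME y. y a = x \<and> (\<forall>i<B. y i < B ^ L) \<and>
     (\<forall>i<B. \<forall>i'<B. i \<noteq> i' \<longrightarrow> agree B L (y i) (y i') = t))"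

lemma fan:
  assumes "a < B" "x < B ^ L" "t < L"
  shows "fan B L x t a a = x" and "i < B \<Longrightarrow> fan B L x t a i < B ^ L"
    and "i < B \<Longrightarrow> i' < B \<Longrightarrow> i \<noteq> i' \<Longrightarrow> agree B L (fan B L x t a i) (fan B L x t a i') = t"
proof -
  have "fan B L x t a a = x \<and> (\<forall>i<B. fan B L x t a i < B ^ L) \<and>
     (\<forall>i<B. \<forall>i'<B. i \<noteq> i' \<longrightarrow> agree B L (fan B L x t a i) (fan B L x t a i') = t)"
    unfolding fan_def by (rule someI_ex[OF agree_fan]) (use assms in auto)
  then show "fan B L x t a a = x" "i < B \<Longrightarrow> fan B L x t a i < B ^ L"
    "i < B \<Longrightarrow> i' < B \<Longrightarrow> i \<noteq> i' \<Longrightarrow> agree B L (fan B L x t a i) (fan B L x t a i') = t" by auto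
qed

text \<open>The vertex \<open>i # a # p\<close> is reached from \<open>p\<close> through the pivot
  \<open>a # p\<close>, whose neighbour with index \<open>a\<close> is \<open>p\<close> itself;
  hence the fan through the value of \<open>p\<close> at index \<open>a\<close>. At the pivot
  \<open>[]\<close> there is no grandparent, and the fan starts from 0.\<close>

fun unfold_tree :: "nat \<Rightarrow> nat \<Rightarrow> (nat list \<Rightarrow> nat) \<Rightarrow> nat list \<Rightarrow> nat" where
  "unfold_tree B L v [] = 0"
| "unfold_tree B L v [m] = fan B L 0 (v []) 0 m"
| "unfold_tree B L v (i # a # p) = fan B L (unfold_tree B L v p) (v (a # p)) a i"

lemma unfold_tree_less:
  assumes "0 < B" "\<And>p. p \<in> verts B \<Longrightarrow> v p < L" "p \<in> verts B"
  shows "unfold_tree B L v p < B ^ L"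
  using assms(3)
proof (induction p rule: induct_list012)
  case (3 i a p)
  then show ?case using Cons_in_vertsD[OF 3(3)] Cons_in_vertsD[of a p B]
    by (auto intro!: fan assms(2))
qed (use assms in \<open>auto intro!: fan\<close>)

lemma unfold_tree_flip:
  assumes "a # p \<in> verts B" "\<And>p. p \<in> verts B \<Longrightarrow> v p < L" "i < B"
  shows "unfold_tree B L v (flip i (a # p)) = fan B L (unfold_tree B L v p) (v (a # p)) a i"
  using Cons_in_vertsD[OF assms(1)] assms unfold_tree_less[of B v L p] by (auto simp: fan)

text \<open>All neighbours of a pivot, including the one towards the root, are members of one
  fan.\<close>

lemma compatible_unfold_tree:
  assumes "0 < B" "\<And>p. p \<in> verts B \<Longrightarrow> v p < L"
  shows "compatible B L (unfold_tree B L v) v (verts B)"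
proof -
  have "agree B L (unfold_tree B L v (flip i q)) (unfold_tree B L v (flip i' q)) = v q"
    if q: "q \<in> verts B" and i: "i < B" "i' < B" "i \<noteq> i'" for q i i'
  proof (cases q)
    case Nil
    then show ?thesis using i assms q by (simp add: fan)
  next
    case (Cons a p)
    then show ?thesis
      using q i assms unfold_tree_flip[of a p B v L] Cons_in_vertsD[of a p B] unfold_tree_less[of B v L p]
      by (simp add: fan del: flip_Cons)
  qed
  then show ?thesis by (auto simp: compatible_def nbrs_def)
qed

section \<open>Random valuations of the tree\<close>

definition tree_involution :: "nat \<Rightarrow> (nat list \<Rightarrow> nat list) \<Rightarrow> bool" where
  "tree_involution B t \<longleftrightarrow> (\<forall>p\<in>verts B. t p \<in> verts B \<and> t (t p) = p \<and>
     (even (length (t p)) \<longleftrightarrow> even (length p)) \<and> t ` nbrs B p = nbrs B (t p))"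

lemma tree_involutionD:
  assumes "tree_involution B t" "p \<in> verts B"
  shows "t p \<in> verts B" "t (t p) = p" "even (length (t p)) \<longleftrightarrow> even (length p)"
    "t ` nbrs B p = nbrs B (t p)"
  using assms by (auto simp: tree_involution_def)

lemma tree_involution_id: "tree_involution B (\<lambda>p. p)"
  by (simp add: tree_involution_def)

lemma inj_on_tree_involution: "tree_involution B t \<Longrightarrow> inj_on t (verts B)"
  by (metis inj_on_def tree_involutionD(2))

text \<open>Right multiplication by the letter \<open>j\<close> in the group of reduced words: it commutes with
  every \<^const>\<open>flip\<close> and exchanges the root with its neighbour \<open>[j]\<close>.\<close>

definition rflip :: "nat \<Rightarrow> nat list \<Rightarrow> nat list" where
  "rflip j p = (if p \<noteq> [] \<and> last p = j then butlast p else p @ [j])"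

lemma rflip_flip: "flip i (rflip j p) = rflip j (flip i p)"
  by (cases p; cases "tl p") (auto simp: rflip_def)

lemma rflip_rflip: "p \<in> verts B \<Longrightarrow> rflip j (rflip j p) = p"
  by (cases p rule: rev_cases)
    (auto simp: rflip_def verts_def distinct_adj_append_iff butlast_append)

lemma rflip_in_verts: "p \<in> verts B \<Longrightarrow> j < B \<Longrightarrow> rflip j p \<in> verts B"
  by (cases p rule: rev_cases)
    (auto simp: rflip_def verts_def distinct_adj_append_iff)

lemma even_length_rflip: "even (length (rflip j p)) \<longleftrightarrow> odd (length p)"
  by (cases p rule: rev_cases) (auto simp: rflip_def)

text \<open>Conjugating the exchange of the letters \<open>i\<close> and \<open>j\<close> by right
  multiplication moves its fixed point from the root to \<open>[j]\<close>. Any line of the node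
  \<open>[j]\<close> can thus be exchanged with the line \<open>[]\<close>.\<close>

lemma ex_tree_involution:
  assumes "i < B" "j < B"
  shows "\<exists>t. tree_involution B t \<and> t [j] = [j] \<and> t [] = flip i [j]"
proof -
  define \<tau> where "\<tau> = Transposition.transpose i j"
  have \<tau>: "\<tau> permutes {..<B}" unfolding \<tau>_def using assms by (intro permutes_swap_id) auto
  then have inj: "\<tau> a = \<tau> b \<longleftrightarrow> a = b" for a b by (simp add: permutes_inj inj_eq)
  have \<tau>\<tau>: "\<tau> (\<tau> a) = a" for a by (simp add: \<tau>_def)
  have map_flip: "map \<tau> (flip a p) = flip (\<tau> a) (map \<tau> p)" for a p
    by (cases p) (auto simp: inj)
  have map_verts: "map \<tau> p \<in> verts B" if "p \<in> verts B" for p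
  proof -
    have "\<tau> a < B" if "a < B" for a using permutes_in_image[OF \<tau>, of a] that by simp
    moreover have "distinct_adj (map \<tau> p)"
      using that inj by (simp add: verts_def distinct_adj_map_iff inj_on_def)
    ultimately show ?thesis using that by (auto simp: verts_def)
  qed
  define t where "t p = rflip j (map \<tau> (rflip j p))" for p
  have "t p \<in> verts B \<and> t (t p) = p \<and> (even (length (t p)) \<longleftrightarrow> even (length p)) \<and>
      t ` nbrs B p = nbrs B (t p)" if p: "p \<in> verts B" for p
  proof (intro conjI)
    have v: "map \<tau> (rflip j p) \<in> verts B"
      using p assms by (intro map_verts rflip_in_verts)
    show "t p \<in> verts B" unfolding t_def by (intro rflip_in_verts v assms)
    show "t (t p) = p"
      using rflip_rflip[OF v] rflip_rflip[OF p] by (simp add: t_def \<tau>\<tau> comp_def)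
    show "even (length (t p)) \<longleftrightarrow> even (length p)"
      by (simp add: t_def even_length_rflip)
    have "t ` nbrs B p = (\<lambda>a. flip (\<tau> a) (t p)) ` {..<B}"
      by (simp add: nbrs_def t_def image_image map_flip rflip_flip[symmetric])
    also have "\<dots> = (\<lambda>a. flip a (t p)) ` \<tau> ` {..<B}" by (simp add: image_image)
    finally show "t ` nbrs B p = nbrs B (t p)" by (simp add: nbrs_def permutes_image[OF \<tau>])
  qed
  then have "tree_involution B t" by (simp add: tree_involution_def)
  moreover have "t [j] = [j]" by (simp add: t_def rflip_def)
  moreover have "t [] = flip i [j]" by (auto simp: t_def rflip_def \<tau>_def)
  ultimately show ?thesis by blast
qed

lemma tree_involution_ball:
  assumes "tree_involution B t" "o' \<in> verts B" "t o' = o'"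
  shows "t ` tree_ball B o' k = tree_ball B o' k"
proof (induction k)
  case (Suc k)
  have "t ` tree_ball B o' (Suc k) = (\<Union>q\<in>tree_ball B o' k. nbrs B (t q))"
    unfolding tree_ball.simps image_UN
    using tree_involutionD(4)[OF assms(1)] ball_subset_verts[OF assms(2), of k] by (intro SUP_cong) auto
  also have "\<dots> = (\<Union>q\<in>t ` tree_ball B o' k. nbrs B q)" by simp
  finally show ?case using Suc by simp
qed (use assms in simp)

section \<open>Histories of all stages and their random choice\<close>

primrec level :: "nat \<Rightarrow> nat \<Rightarrow> nat" where
  "level B 0 = B"
| "level B (Suc k) = B ^ level B k"

lemma level_pos: "0 < B \<Longrightarrow> 0 < level B k"
  by (cases k) auto

definition letter :: "nat list \<Rightarrow> nat" where
  "letter p = (case p of [] \<Rightarrow> 0 | a # q \<Rightarrow> a)"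

text \<open>The bound \<open>level B k\<close> on the values of stage \<open>k\<close> is also the
  number of digits at stage \<open>Suc k\<close>, so a value prescribes the length of a proper
  prefix.\<close>

definition valid_history :: "nat \<Rightarrow> nat \<Rightarrow> (nat \<Rightarrow> nat list \<Rightarrow> nat) \<Rightarrow> bool" where
  "valid_history B K h \<longleftrightarrow> h 0 = letter \<and> (\<forall>k\<le>K. \<forall>p\<in>verts B. h k p < level B k) \<and>
     (\<forall>k<K. compatible B (level B k) (h (Suc k)) (h k) (verts B))"

lemma valid_history_agree_in:
  assumes "valid_history B K h" "j < B" "k < K"
    "p \<in> tree_ball B [j] (Suc k)" "p' \<in> tree_ball B [j] (Suc k)" "p \<noteq> p'"
    "inj_on (h k) (tree_ball B [j] k)"
  shows "agree B (level B k) (h (Suc k) p) (h (Suc k) p') \<in> h k ` tree_ball B [j] k"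
proof -
  have "compatible B (level B k) (h (Suc k)) (h k) (tree_ball B [j] k)"
    by (rule compatible_subset[of _ _ _ _ "verts B"])
      (use assms ball_subset_verts[of "[j]" B k] in \<open>auto simp: valid_history_def\<close>)
  then show ?thesis using agree_determined_ball(2) assms by blast
qed

text \<open>Equal values would agree in all \<open>level B k\<close> digits, whereas the agreement
  of distinct vertices is a value of stage \<open>k\<close> and therefore smaller.\<close>

lemma valid_history_inj_on:
  assumes "valid_history B K h" "j < B" "k \<le> K"
  shows "inj_on (h k) (tree_ball B [j] k)"
  using assms(3)
proof (induction k)
  case (Suc k)
  show ?case
  proof (rule inj_onI, rule ccontr)
    fix p p' assume p: "p \<in> tree_ball B [j] (Suc k)" "p' \<in> tree_ball B [j] (Suc k)"
      and eq: "h (Suc k) p = h (Suc k) p'" and "p \<noteq> p'"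
    have "level B k \<in> h k ` tree_ball B [j] k"
      using valid_history_agree_in[OF assms(1,2) _ p \<open>p \<noteq> p'\<close>] Suc eq by simp
    then obtain q where q: "q \<in> tree_ball B [j] k" "h k q = level B k" by (metis imageE)
    have "q \<in> verts B" using q(1) ball_subset_verts[of "[j]" B k] assms(2) by auto
    then have "h k q < level B k" using assms(1) Suc.prems by (simp add: valid_history_def)
    with q(2) show False by simp
  qed
qed simp

text \<open>A uniformly random isometry is applied to one solution of the compatibility constraints,
  so that the law on a ball forgets the choices made in \<open>fan\<close> and
  \<open>unfold_tree\<close>.\<close>

primrec history_pmf :: "nat \<Rightarrow> nat \<Rightarrow> (nat \<Rightarrow> nat list \<Rightarrow> nat) pmf" where
  "history_pmf B 0 = return_pmf (\<lambda>_. letter)"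
| "history_pmf B (Suc k) = bind_pmf (history_pmf B k) (\<lambda>h.
     map_pmf (\<lambda>\<alpha>. h(Suc k := \<alpha> \<circ> unfold_tree B (level B k) (h k)))
       (pmf_of_set (agree_perms B (level B k))))"

lemma set_pmf_agree_perms [simp]: "set_pmf (pmf_of_set (agree_perms B L)) = agree_perms B L"
  using finite_agree_perms id_in_agree_perms by (intro set_pmf_of_set) blast+

lemma valid_history_pmf:
  assumes "0 < B" "h \<in> set_pmf (history_pmf B K)"
  shows "valid_history B K h"
  using assms(2)
proof (induction K arbitrary: h)
  case 0
  have "letter p < B" if "p \<in> verts B" for p
    using that assms(1) by (cases p) (auto simp: letter_def dest: Cons_in_vertsD)
  then show ?case using 0 by (auto simp: valid_history_def)
next
  case (Suc K)
  let ?L = "level B K"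
  obtain g \<alpha> where g: "valid_history B K g" and \<alpha>: "\<alpha> \<in> agree_perms B ?L"
    and h: "h = g(Suc K := \<alpha> \<circ> unfold_tree B ?L (g K))"
    using Suc by auto
  have lt: "g K p < ?L" if "p \<in> verts B" for p using g that by (auto simp: valid_history_def)
  have ul: "unfold_tree B ?L (g K) p < B ^ ?L" if "p \<in> verts B" for p
    by (rule unfold_tree_less[OF assms(1) lt that])
  have "compatible B ?L (\<alpha> \<circ> unfold_tree B ?L (g K)) (g K) (verts B)"
    unfolding compatible_def
  proof (intro ballI impI)
    fix q p p' assume q: "q \<in> verts B" and p: "p \<in> nbrs B q" "p' \<in> nbrs B q" "p \<noteq> p'"
    then have "p \<in> verts B" "p' \<in> verts B" using nbrs_subset_verts by blast+
    then have "agree B ?L ((\<alpha> \<circ> unfold_tree B ?L (g K)) p) ((\<alpha> \<circ> unfold_tree B ?L (g K)) p') =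
        agree B ?L (unfold_tree B ?L (g K) p) (unfold_tree B ?L (g K) p')"
      using \<alpha> ul by (simp add: agree_perms_def)
    also have "\<dots> = g K q"
      by (rule compatible_nbrs[OF compatible_unfold_tree[OF assms(1) lt] q p])
    finally show "agree B ?L ((\<alpha> \<circ> unfold_tree B ?L (g K)) p) ((\<alpha> \<circ> unfold_tree B ?L (g K)) p') =
        g K q" .
  qed
  moreover have "(\<alpha> \<circ> unfold_tree B ?L (g K)) p < level B (Suc K)" if "p \<in> verts B" for p
    using agree_perms_less[OF \<alpha> ul[OF that]] by simp
  ultimately show ?case using g h by (auto simp: valid_history_def less_Suc_eq le_Suc_eq)
qed

text \<open>By homogeneity \<open>u\<close> and \<open>u'\<close> differ on \<open>D\<close> by an
  isometry, which the uniform isometry absorbs.\<close>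

lemma map_pmf_agree_perms_cong:
  assumes "0 < B" "\<And>p. p \<in> D \<Longrightarrow> u p < B ^ L" "\<And>p. p \<in> D \<Longrightarrow> u' p < B ^ L"
    and "\<And>p q. p \<in> D \<Longrightarrow> q \<in> D \<Longrightarrow> agree B L (u p) (u q) = agree B L (u' p) (u' q)"
  shows "map_pmf (\<lambda>\<alpha> p. if p \<in> D then \<alpha> (u p) else 0) (pmf_of_set (agree_perms B L)) =
         map_pmf (\<lambda>\<alpha> p. if p \<in> D then \<alpha> (u' p) else 0) (pmf_of_set (agree_perms B L))"
proof -
  have "\<exists>\<beta>\<in>agree_perms B L. \<forall>p\<in>D. \<beta> (u p) = u' p"
    by (rule agree_perms_extend[OF assms])
  then obtain \<beta> where \<beta>: "\<beta> \<in> agree_perms B L" "\<And>p. p \<in> D \<Longrightarrow> \<beta> (u p) = u' p" by blast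
  have "pmf_of_set (agree_perms B L) = map_pmf (\<lambda>\<alpha>. \<alpha> \<circ> \<beta>) (pmf_of_set (agree_perms B L))"
    by (rule map_pmf_of_set_bij_betw[symmetric, OF bij_betw_comp_agree_perms[OF \<beta>(1)]])
      (use finite_agree_perms \<beta>(1) in auto)
  then have "map_pmf (\<lambda>\<alpha> p. if p \<in> D then \<alpha> (u p) else 0) (pmf_of_set (agree_perms B L)) =
      map_pmf (\<lambda>\<alpha> p. if p \<in> D then \<alpha> (u p) else 0)
        (map_pmf (\<lambda>\<alpha>. \<alpha> \<circ> \<beta>) (pmf_of_set (agree_perms B L)))" by (rule arg_cong)
  also have "\<dots> = map_pmf (\<lambda>\<alpha> p. if p \<in> D then \<alpha> (u' p) else 0) (pmf_of_set (agree_perms B L))"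
    unfolding map_pmf_comp by (intro map_pmf_cong refl) (auto simp: \<beta>(2) fun_eq_iff)
  finally show ?thesis .
qed

text \<open>Stage \<open>k\<close> is kept only on the ball of radius \<open>k\<close>. There a
  valid history is injective, so the agreements at the next stage depend on retained values
  only.\<close>

definition local_history ::
    "nat \<Rightarrow> nat \<Rightarrow> nat \<Rightarrow> (nat \<Rightarrow> nat list \<Rightarrow> nat) \<Rightarrow> nat \<Rightarrow> nat list \<Rightarrow> nat" where
  "local_history B j K h = (\<lambda>k p. if k \<le> K \<and> p \<in> tree_ball B [j] k then h k p else 0)"

definition history_kernel ::
    "nat \<Rightarrow> nat \<Rightarrow> nat \<Rightarrow> (nat \<Rightarrow> nat list \<Rightarrow> nat) \<Rightarrow> (nat \<Rightarrow> nat list \<Rightarrow> nat) pmf" where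
  "history_kernel B j k g = map_pmf (\<lambda>u. g(Suc k := u))
     (map_pmf (\<lambda>\<alpha> p. if p \<in> tree_ball B [j] (Suc k)
         then \<alpha> (unfold_tree B (level B k) (g k) p) else 0)
       (pmf_of_set (agree_perms B (level B k))))"

text \<open>The local stages form a Markov chain whose kernel does not mention \<open>t\<close>: the
  relabelled tree and a tree unfolded from the local values are compatible with the same pivots, so
  they have equal agreements on the ball, and a random isometry gives them the same law.\<close>

lemma local_history_Suc:
  assumes B: "0 < B" and j: "j < B" and t: "tree_involution B t" "t [j] = [j]"
  shows "map_pmf (\<lambda>h. local_history B j (Suc k) (\<lambda>i p. h i (t p))) (history_pmf B (Suc k)) =
    bind_pmf (map_pmf (\<lambda>h. local_history B j k (\<lambda>i p. h i (t p))) (history_pmf B k))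
      (history_kernel B j k)"
proof -
  let ?L = "level B k" and ?D = "tree_ball B [j] (Suc k)"
  have "map_pmf (\<lambda>\<alpha>. local_history B j (Suc k)
          (\<lambda>i p. (h(Suc k := \<alpha> \<circ> unfold_tree B ?L (h k))) i (t p)))
          (pmf_of_set (agree_perms B ?L)) =
        history_kernel B j k (local_history B j k (\<lambda>i p. h i (t p)))"
    if h: "h \<in> set_pmf (history_pmf B k)" for h
  proof -
    define g where "g = local_history B j k (\<lambda>i p. h i (t p))"
    have v: "valid_history B k h" using valid_history_pmf[OF B h] .
    have bv: "tree_ball B [j] i \<subseteq> verts B" for i using ball_subset_verts[of "[j]" B i] j by simp
    have tv: "t p \<in> verts B" if "p \<in> verts B" for p using tree_involutionD(1)[OF t(1) that] .
    have tb: "t ` tree_ball B [j] i = tree_ball B [j] i" for i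
      using tree_involution_ball[OF t(1) _ t(2)] j by simp
    have hlt: "h k p < ?L" if "p \<in> verts B" for p using v that by (auto simp: valid_history_def)
    have glt: "g k p < ?L" if "p \<in> verts B" for p
      using hlt tv that level_pos[OF B, of k] by (auto simp: g_def local_history_def)
    have gk: "g k p = h k (t p)" if "p \<in> tree_ball B [j] k" for p
      using that by (simp add: g_def local_history_def)
    have inj: "inj_on (g k) (tree_ball B [j] k)"
    proof -
      have "inj_on (h k) (t ` tree_ball B [j] k)"
        using valid_history_inj_on[OF v j] tb by simp
      then have "inj_on (h k \<circ> t) (tree_ball B [j] k)"
        using inj_on_subset[OF inj_on_tree_involution[OF t(1)] bv] by (rule comp_inj_on[rotated])
      then show ?thesis by (rule inj_on_cong[THEN iffD1, rotated]) (simp add: gk)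
    qed
    have c1: "compatible B ?L (unfold_tree B ?L (g k)) (g k) (tree_ball B [j] k)"
      using compatible_subset[OF compatible_unfold_tree[OF B glt] bv] .
    have c2: "compatible B ?L (\<lambda>p. unfold_tree B ?L (h k) (t p)) (g k) (tree_ball B [j] k)"
      unfolding compatible_def
    proof (intro ballI impI)
      fix q p p' assume q: "q \<in> tree_ball B [j] k" and p: "p \<in> nbrs B q" "p' \<in> nbrs B q" "p \<noteq> p'"
      have qv: "q \<in> verts B" using q bv by blast
      then have pv: "p \<in> verts B" "p' \<in> verts B" using p nbrs_subset_verts by blast+
      have "t p \<in> nbrs B (t q)" "t p' \<in> nbrs B (t q)"
        using tree_involutionD(4)[OF t(1) qv] p by blast+
      moreover have "t p \<noteq> t p'" using tree_involutionD(2)[OF t(1)] pv p(3) by metis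
      ultimately have "agree B ?L (unfold_tree B ?L (h k) (t p)) (unfold_tree B ?L (h k) (t p')) = h k (t q)"
        by (intro compatible_nbrs[OF compatible_unfold_tree[OF B hlt] tv[OF qv]])
      then show "agree B ?L (unfold_tree B ?L (h k) (t p)) (unfold_tree B ?L (h k) (t p')) = g k q"
        by (simp add: gk[OF q])
    qed
    have "map_pmf (\<lambda>\<alpha>. local_history B j (Suc k)
          (\<lambda>i p. (h(Suc k := \<alpha> \<circ> unfold_tree B ?L (h k))) i (t p)))
          (pmf_of_set (agree_perms B ?L)) =
        map_pmf (\<lambda>u. g(Suc k := u)) (map_pmf (\<lambda>\<alpha> p. if p \<in> ?D
          then \<alpha> (unfold_tree B ?L (h k) (t p)) else 0) (pmf_of_set (agree_perms B ?L)))"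
      unfolding map_pmf_comp
      by (intro map_pmf_cong refl) (auto simp: g_def local_history_def fun_eq_iff)
    also have "map_pmf (\<lambda>\<alpha> p. if p \<in> ?D
          then \<alpha> (unfold_tree B ?L (h k) (t p)) else 0) (pmf_of_set (agree_perms B ?L)) =
        map_pmf (\<lambda>\<alpha> p. if p \<in> ?D
          then \<alpha> (unfold_tree B ?L (g k) p) else 0) (pmf_of_set (agree_perms B ?L))"
    proof (rule map_pmf_agree_perms_cong[OF B])
      show "agree B ?L (unfold_tree B ?L (h k) (t p)) (unfold_tree B ?L (h k) (t q)) =
          agree B ?L (unfold_tree B ?L (g k) p) (unfold_tree B ?L (g k) q)"
        if "p \<in> ?D" "q \<in> ?D" for p q
        using agree_determined_ball(1)[OF j inj c2 c1 that] by (cases "p = q") auto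
      fix p assume "p \<in> ?D"
      then have "p \<in> verts B" using bv by blast
      then show "unfold_tree B ?L (h k) (t p) < B ^ ?L" by (intro unfold_tree_less[OF B hlt] tv)
      show "unfold_tree B ?L (g k) p < B ^ ?L" by (rule unfold_tree_less) (use B glt \<open>p \<in> verts B\<close> in auto)
    qed
    finally show ?thesis unfolding history_kernel_def g_def .
  qed
  note step = this
  show ?thesis
    unfolding history_pmf.simps map_bind_pmf bind_map_pmf map_pmf_comp
    by (intro bind_pmf_cong refl step)
qed

lemma local_history_invariant:
  assumes "0 < B" "j < B" "tree_involution B t" "t [j] = [j]"
  shows "map_pmf (\<lambda>h. local_history B j K (\<lambda>i p. h i (t p))) (history_pmf B K) =
         map_pmf (local_history B j K) (history_pmf B K)"
proof (induction K)
  case 0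
  \<comment> \<open>The ball at stage 0 is the single node \<open>[j]\<close>, which
    \<open>t\<close> fixes.\<close>
  show ?case using assms by (simp add: local_history_def fun_eq_iff)
next
  case (Suc k)
  have "map_pmf (\<lambda>h. local_history B j (Suc k) (\<lambda>i p. h i (t p))) (history_pmf B (Suc k)) =
      bind_pmf (map_pmf (local_history B j k) (history_pmf B k)) (history_kernel B j k)"
    unfolding local_history_Suc[OF assms] Suc ..
  also have "\<dots> = map_pmf (local_history B j (Suc k)) (history_pmf B (Suc k))"
    using local_history_Suc[OF assms(1,2) tree_involution_id, of k] by simp
  finally show ?case .
qed

section \<open>Pulling back an output\<close>

text \<open>Both predicates pull the output \<open>w\<close> back from stage \<open>k\<close> to stage 0. In \<open>hit\<close> this only uses
  values that do not depend on \<open>j\<close>, so the node \<open>[j]\<close> enters through the tests alone; any two nodes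
  of the line give the same minimum, and \<open>[0]\<close> is an arbitrary choice among them. Dually, \<open>caught\<close>
  pulls back relative to the node \<open>[j]\<close> and tests whether the line \<open>g\<close> is singled out.\<close>

primrec hit :: "nat \<Rightarrow> (nat \<Rightarrow> nat list \<Rightarrow> nat) \<Rightarrow> nat \<Rightarrow> nat \<Rightarrow> nat \<Rightarrow> bool" where
  "hit B h j 0 w \<longleftrightarrow> w = j"
| "hit B h j (Suc k) w \<longleftrightarrow> (if odd k
     then h k [] < agree B (level B k) w (h (Suc k) [j]) \<or>
       hit B h j k (min (agree B (level B k) w (h (Suc k) [0])) (h k []))
     else hit B h j k (agree B (level B k) w (h (Suc k) [])))"

primrec caught :: "nat \<Rightarrow> (nat \<Rightarrow> nat list \<Rightarrow> nat) \<Rightarrow> nat \<Rightarrow> nat list \<Rightarrow> nat \<Rightarrow> nat \<Rightarrow> bool" where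
  "caught B h j g 0 w \<longleftrightarrow> False"
| "caught B h j g (Suc k) w \<longleftrightarrow> (if odd k
     then caught B h j g k (agree B (level B k) w (h (Suc k) [j]))
     else h k [j] < agree B (level B k) w (h (Suc k) g) \<or>
       caught B h j g k (min (agree B (level B k) w (h (Suc k) [])) (h k [j])))"

lemma valid_history_agree:
  assumes "valid_history B K h" "k < K" "q \<in> verts B" "p \<in> nbrs B q" "p' \<in> nbrs B q" "p \<noteq> p'"
  shows "agree B (level B k) (h (Suc k) p) (h (Suc k) p') = h k q"
  using assms compatible_nbrs[of B "level B k" "h (Suc k)" "h k" "verts B" q p p']
  by (simp add: valid_history_def)

text \<open>The number carried down does not depend on \<open>j\<close>. Each step over an odd stage
  adds at most one node, since the nodes of the line \<open>[]\<close> agree pairwise in exactly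
  \<open>h k []\<close> digits, and stage 0 adds one more.\<close>

lemma card_hit:
  assumes "valid_history B K h" "k \<le> K"
  shows "card {j. j < B \<and> hit B h j k w} \<le> Suc (k div 2)"
  using assms(2)
proof (induction k arbitrary: w)
  case 0
  have "{j. j < B \<and> hit B h j 0 w} \<subseteq> {w}" by auto
  then show ?case using card_mono[of "{w}"] by fastforce
next
  case (Suc k)
  show ?case
  proof (cases "odd k")
    case True
    let ?P = "{j. j < B \<and> h k [] < agree B (level B k) w (h (Suc k) [j])}"
    let ?H = "{j. j < B \<and> hit B h j k (min (agree B (level B k) w (h (Suc k) [0])) (h k []))}"
    have "card ?P \<le> 1"
    proof -
      have "i = j" if "i \<in> ?P" "j \<in> ?P" for i j
      proof (rule ccontr)
        assume "i \<noteq> j"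
        have "[i] \<in> nbrs B []" "[j] \<in> nbrs B []" using that by (auto simp: nbrs_def)
        then have "agree B (level B k) (h (Suc k) [i]) (h (Suc k) [j]) = h k []"
          using valid_history_agree[OF assms(1), of k "[]" "[i]" "[j]"] Suc.prems \<open>i \<noteq> j\<close> by simp
        then show False using agree_above_unique[of "h k []" B "level B k" w "h (Suc k) [i]" "h (Suc k) [j]"] that
          by simp
      qed
      then show ?thesis by (simp add: card_le_Suc0_iff_eq)
    qed
    moreover have "card ?H \<le> Suc (k div 2)" using Suc by simp
    moreover have "{j. j < B \<and> hit B h j (Suc k) w} = ?P \<union> ?H" using True by auto
    ultimately have "card {j. j < B \<and> hit B h j (Suc k) w} \<le> Suc (Suc (k div 2))"
      using card_Un_le[of ?P ?H] by simp
    then show ?thesis using True by (simp add: odd_Suc_div_two)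
  next
    case False
    then show ?thesis using Suc.IH[of "agree B (level B k) w (h (Suc k) [])"] Suc.prems
      by (simp add: even_Suc_div_two)
  qed
qed

text \<open>The dual count: each step over an even stage adds at most one of the lines of
  \<open>[j]\<close>, and stage 0 adds none.\<close>

lemma card_caught:
  assumes "valid_history B K h" "k \<le> K" "j < B"
  shows "card {g \<in> nbrs B [j]. caught B h j g k w} \<le> Suc k div 2"
  using assms(2)
proof (induction k arbitrary: w)
  case (Suc k)
  show ?case
  proof (cases "odd k")
    case True
    then show ?thesis using Suc.IH[of "agree B (level B k) w (h (Suc k) [j])"] Suc.prems by simp
  next
    case False
    let ?P = "{g \<in> nbrs B [j]. h k [j] < agree B (level B k) w (h (Suc k) g)}"
    let ?H = "{g \<in> nbrs B [j]. caught B h j g k (min (agree B (level B k) w (h (Suc k) [])) (h k [j]))}"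
    have "card ?P \<le> 1"
    proof -
      have "g = g'" if "g \<in> ?P" "g' \<in> ?P" for g g'
      proof (rule ccontr)
        assume "g \<noteq> g'"
        then have "agree B (level B k) (h (Suc k) g) (h (Suc k) g') = h k [j]"
          using valid_history_agree[OF assms(1), of k "[j]" g g'] Suc.prems that assms(3) by simp
        then show False using agree_above_unique[of "h k [j]" B "level B k" w "h (Suc k) g" "h (Suc k) g'"] that
          by simp
      qed
      then show ?thesis by (simp add: card_le_Suc0_iff_eq)
    qed
    moreover have "card ?H \<le> Suc k div 2" using Suc by simp
    moreover have "{g \<in> nbrs B [j]. caught B h j g (Suc k) w} = ?P \<union> ?H" using False by auto
    ultimately have "card {g \<in> nbrs B [j]. caught B h j g (Suc k) w} \<le> Suc (Suc k div 2)"
      using card_Un_le[of ?P ?H] by simp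
    then show ?thesis using False by (simp add: even_Suc_div_two)
  qed
qed simp

lemma singleton_in_ball_even: "j < B \<Longrightarrow> even k \<Longrightarrow> [j] \<in> tree_ball B [j] k"
  using ball_mono[of "[j]" B 0 k] by auto

lemma Nil_in_ball_odd: "j < B \<Longrightarrow> even k \<Longrightarrow> [] \<in> tree_ball B [j] (Suc k)"
  using singleton_in_ball_even[of j B k] by (auto simp: nbrs_def intro!: bexI[of _ "[j]"] rev_image_eqI[of j])

text \<open>The hypotheses are the invariant of the descent: the output stays between values of the
  ball, with the upper bound \<open>h k []\<close> at odd stages. If no test succeeds, the descent
  ends in the one-point ball of stage 0, where the output must be \<open>j\<close>.\<close>

lemma hit_or_caught:
  assumes valid: "valid_history B K h" and j: "j < B" and "k \<le> K"
    and "\<exists>p\<in>tree_ball B [j] k. h k p \<le> w"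
    and "if even k then \<exists>p\<in>tree_ball B [j] k. w \<le> h k p else w \<le> h k []"
  shows "hit B h j k w \<or> caught B h j [] k w"
  using assms(3-)
proof (induction k arbitrary: w)
  case 0
  then show ?case using valid by (auto simp: valid_history_def letter_def)
next
  case (Suc k)
  let ?L = "level B k"
  have inj: "inj_on (h k) (tree_ball B [j] k)"
    using valid_history_inj_on[OF valid j, of k] Suc.prems(1) by simp
  have agree_in: "agree B ?L (h (Suc k) p) (h (Suc k) p') \<in> h k ` tree_ball B [j] k"
    if "p \<in> tree_ball B [j] (Suc k)" "p' \<in> tree_ball B [j] (Suc k)" "p \<noteq> p'" for p p'
    using valid_history_agree_in[OF valid j _ that inj] Suc.prems(1) by simp
  have lt: "h k p < ?L" if "p \<in> verts B" for p
    using valid that Suc.prems(1) by (auto simp: valid_history_def)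
  show ?case
  proof (cases "odd k")
    case True
    obtain p p' where p: "p \<in> tree_ball B [j] (Suc k)" "p' \<in> tree_ball B [j] (Suc k)"
      "h (Suc k) p \<le> w" "w \<le> h (Suc k) p'"
      using Suc.prems True by auto
    have jb: "[j] \<in> tree_ball B [j] (Suc k)" using singleton_in_ball_even[OF j, of "Suc k"] True by simp
    let ?w = "agree B ?L w (h (Suc k) [j])"
    show ?thesis
    proof (cases "h k [] < ?w")
      case True
      then show ?thesis using \<open>odd k\<close> by simp
    next
      case False
      then have "w \<noteq> h (Suc k) [j]" using lt[of "[]"] by auto
      \<comment> \<open>Take a ball vertex on the far side of \<open>w\<close> from
        \<open>[j]\<close>: its agreement with \<open>[j]\<close> is a lower bound, and is itself a
        value of the ball one stage down.\<close>
      have "\<exists>q\<in>tree_ball B [j] (Suc k). q \<noteq> [j] \<and> agree B ?L (h (Suc k) q) (h (Suc k) [j]) \<le> ?w"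
      proof (cases "w \<le> h (Suc k) [j]")
        case True
        then have "p \<noteq> [j]" using p \<open>w \<noteq> h (Suc k) [j]\<close> by auto
        then show ?thesis using agree_between(2)[OF p(3) True, of B ?L] p(1) by blast
      next
        case False
        then have "p' \<noteq> [j]" "h (Suc k) [j] \<le> w" using p by auto
        then show ?thesis
          using agree_between(1)[OF _ p(4), of "h (Suc k) [j]" B ?L] p(2) agree_sym by metis
      qed
      then have low: "\<exists>q\<in>tree_ball B [j] k. h k q \<le> ?w" using agree_in[OF _ jb] by (metis imageE)
      have eq: "min (agree B ?L w (h (Suc k) [0])) (h k []) = ?w"
      proof (cases "j = 0")
        case nz: False
        have "[0] \<in> nbrs B []" "[j] \<in> nbrs B []" using j by (auto simp: nbrs_def)
        then have "agree B ?L (h (Suc k) [0]) (h (Suc k) [j]) = h k []"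
          using valid_history_agree[OF valid, of k "[]" "[0]" "[j]"] Suc.prems nz by simp
        then show ?thesis using agree_cap_cong[of B ?L w "h (Suc k) [0]" "h (Suc k) [j]"] False by simp
      qed (use False in simp)
      have "hit B h j k ?w \<or> caught B h j [] k ?w"
        using Suc.IH[of ?w] low False \<open>odd k\<close> Suc.prems(1) by simp
      then show ?thesis using \<open>odd k\<close> eq by auto
    qed
  next
    case False
    then have ek: "even k" by simp
    obtain p where p: "p \<in> tree_ball B [j] (Suc k)" "h (Suc k) p \<le> w" and wle: "w \<le> h (Suc k) []"
      using Suc.prems ek by auto
    have nb: "[] \<in> tree_ball B [j] (Suc k)" using Nil_in_ball_odd[OF j ek] .
    let ?w = "agree B ?L w (h (Suc k) [])"
    show ?thesis
    proof (cases "h k [j] < ?w")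
      case True
      then show ?thesis using ek by simp
    next
      case False
      then have "w \<noteq> h (Suc k) []" using lt[of "[j]"] j by auto
      then have "p \<noteq> []" using p wle by auto
      then have "\<exists>q\<in>tree_ball B [j] k. h k q = agree B ?L (h (Suc k) p) (h (Suc k) [])"
        using agree_in[OF p(1) nb] by (metis imageE)
      then have low: "\<exists>q\<in>tree_ball B [j] k. h k q \<le> ?w"
        using agree_between(2)[OF p(2) wle, of B ?L] by metis
      have "hit B h j k ?w \<or> caught B h j [] k ?w"
        using Suc.IH[of ?w] low False ek Suc.prems(1) singleton_in_ball_even[OF j ek]
        by (simp add: not_less) blast
      then show ?thesis using ek False by (auto simp: min_absorb1 not_less)
    qed
  qed
qed

text \<open>\<open>caught\<close> consults only \<open>[j]\<close>, \<open>[]\<close> and the tested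
  line. Relabelling turns the reference line \<open>[]\<close> into \<open>t []\<close>, but the cap
  at \<open>h k [j]\<close> hides this.\<close>

lemma caught_involution:
  assumes valid: "valid_history B K h" and j: "j < B"
    and t: "tree_involution B t" "t [j] = [j]"
    and h': "\<And>i p. i \<le> K \<Longrightarrow> p \<in> tree_ball B [j] i \<Longrightarrow> h' i p = h i (t p)"
    and "k \<le> K"
  shows "caught B h' j [] k w \<longleftrightarrow> caught B h j (t []) k w"
  using assms(6)
proof (induction k arbitrary: w)
  case (Suc k)
  let ?L = "level B k"
  show ?case
  proof (cases "odd k")
    case True
    then show ?thesis using Suc h'[of "Suc k" "[j]"] singleton_in_ball_even[OF j, of "Suc k"] t(2) by simp
  next
    case False
    then have eqs: "h' (Suc k) [] = h (Suc k) (t [])" "h' k [j] = h k [j]"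
      using Suc.prems h' Nil_in_ball_odd[OF j, of k] singleton_in_ball_even[OF j, of k] t(2) by simp_all
    have n: "[] \<in> nbrs B [j]" using j by (auto simp: nbrs_def intro!: rev_image_eqI[of j])
    have "t [] \<in> t ` nbrs B [j]" using n by blast
    then have tn: "t [] \<in> nbrs B [j]" using tree_involutionD(4)[OF t(1), of "[j]"] t(2) j by simp
    have "min (agree B ?L w (h (Suc k) (t []))) (h k [j]) = min (agree B ?L w (h (Suc k) [])) (h k [j])"
    proof (cases "t [] = []")
      case False
      then have "agree B ?L (h (Suc k) (t [])) (h (Suc k) []) = h k [j]"
        using valid_history_agree[OF valid _ _ tn n] Suc.prems j by simp
      then show ?thesis using agree_cap_cong[of B ?L w "h (Suc k) (t [])" "h (Suc k) []"] by simp
    qed simp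
    then show ?thesis using False Suc eqs by simp
  qed
qed simp

section \<open>Datasets and oracles\<close>

text \<open>Lines in \<open>S\<close> are open, and crossing one costs two tree edges. Later the
  open lines are those whose data element has been removed.\<close>

inductive_set reach :: "nat \<Rightarrow> nat list set \<Rightarrow> nat list \<Rightarrow> nat list set"
  for B :: nat and S :: "nat list set" and p :: "nat list" where
  base: "p \<in> reach B S p"
| step: "x \<in> reach B S p \<Longrightarrow> g \<in> S \<Longrightarrow> g \<in> nbrs B x \<Longrightarrow> y \<in> nbrs B g \<Longrightarrow> y \<in> reach B S p"

lemma reach_trans: "z \<in> reach B S y \<Longrightarrow> y \<in> reach B S x \<Longrightarrow> z \<in> reach B S x"
  by (induction rule: reach.induct) (auto intro: reach.intros)

lemma reach_mono: "x \<in> reach B S p \<Longrightarrow> S \<subseteq> S' \<Longrightarrow> x \<in> reach B S' p"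
  by (induction rule: reach.induct) (auto intro: reach.intros)

lemma reach_in_verts: "x \<in> reach B S p \<Longrightarrow> p \<in> verts B \<Longrightarrow> x \<in> verts B"
  by (induction rule: reach.induct) (use nbrs_subset_verts in blast)+

text \<open>Cutting a walk after its last crossing of the line it used first leaves a walk that
  avoids this line. This permits induction on the number of open lines.\<close>

lemma reach_cases_avoid:
  assumes "x \<in> reach B S p"
  shows "x = p \<or> (\<exists>g\<in>S \<inter> nbrs B p. \<exists>p'\<in>nbrs B g. x \<in> reach B (S - {g}) p')"
  using assms
proof (induction rule: reach.induct)
  case (step x g y)
  from step.IH show ?case
  proof (elim disjE bexE)
    fix g' p' assume g': "g' \<in> S \<inter> nbrs B p" and p': "p' \<in> nbrs B g'" "x \<in> reach B (S - {g'}) p'"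
    show ?thesis
    proof (cases "g = g'")
      case True
      then show ?thesis using g' step.hyps(4) reach.base by blast
    next
      case False
      then have "y \<in> reach B (S - {g'}) p'" using p' step.hyps by (auto intro: reach.step)
      then show ?thesis using g' p' by blast
    qed
  qed (use step.hyps reach.base in blast)
qed simp

lemma reach_local:
  assumes "0 < B" "finite S" "card S \<le> c" "p \<in> verts B" "x \<in> reach B S p"
  shows "x \<in> tree_ball B p (2 * c) \<and> x \<in> reach B (S \<inter> tree_ball B p (2 * c - 1)) p"
  using assms(2-)
proof (induction c arbitrary: S p)
  case 0
  then show ?case using reach_cases_avoid[of x B S p] by (auto intro: reach.base)
next
  case (Suc c)
  have sub2: "tree_ball B p' n \<subseteq> tree_ball B p (Suc (Suc n))" if "g \<in> nbrs B p" "p' \<in> nbrs B g" for g p' n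
    using that unfolding ball_Suc_right by blast
  from reach_cases_avoid[OF Suc.prems(4)] show ?case
  proof (elim disjE bexE)
    assume "x = p"
    then show ?thesis using ball_mono[of p B 0 "2 * Suc c"] Suc.prems(3) assms(1) by (auto intro: reach.base)
  next
    fix g p' assume g: "g \<in> S \<inter> nbrs B p" and p': "p' \<in> nbrs B g" and x: "x \<in> reach B (S - {g}) p'"
    have gv: "g \<in> verts B" using g nbrs_subset_verts[OF Suc.prems(3)] by blast
    have pv: "p' \<in> verts B" using p' nbrs_subset_verts[OF gv] by blast
    have card: "card (S - {g}) \<le> c" using g Suc.prems(1,2) by simp
    have IH: "x \<in> tree_ball B p' (2 * c)" "x \<in> reach B ((S - {g}) \<inter> tree_ball B p' (2 * c - 1)) p'"
      using Suc.IH[OF _ card pv x] Suc.prems(1) by auto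
    have "2 * Suc c = Suc (Suc (2 * c))" by simp
    then have "x \<in> tree_ball B p (2 * Suc c)" using IH(1) sub2[of g p' "2 * c"] g p' by (metis IntD2 subsetD)
    moreover have "(S - {g}) \<inter> tree_ball B p' (2 * c - 1) \<subseteq> S \<inter> tree_ball B p (2 * Suc c - 1)"
    proof (cases c)
      case 0
      \<comment> \<open>Truncated subtraction makes \<open>2 * c - 1\<close> equal to 0 here, which
        breaks the count of radii, but no open line is left.\<close>
      then have "S - {g} = {}" using card Suc.prems(1) by simp
      then show ?thesis by blast
    next
      case (Suc c')
      then have "Suc (Suc (2 * c - 1)) = 2 * Suc c - 1" by simp
      then show ?thesis using sub2[of g p' "2 * c - 1"] g p' by (metis Diff_subset IntD2 Int_mono)
    qed
    then have "x \<in> reach B (S \<inter> tree_ball B p (2 * Suc c - 1)) p'" using reach_mono[OF IH(2)] by blast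
    moreover have "g \<in> tree_ball B p (2 * Suc c - 1)"
      using ball_mono[of p B 1 "2 * Suc c - 1"] Suc.prems(3) assms(1) g by auto
    then have "p' \<in> reach B (S \<inter> tree_ball B p (2 * Suc c - 1)) p"
      using g p' by (intro reach.step[OF reach.base, of g]) auto
    ultimately show ?thesis using reach_trans by blast
  qed
qed

lemma reach_involution:
  assumes "tree_involution B t" "p \<in> verts B" "x \<in> reach B S p"
  shows "t x \<in> reach B (t ` S) (t p)"
  using assms(3)
proof (induction rule: reach.induct)
  case (step x g y)
  have xv: "x \<in> verts B" using reach_in_verts[OF step.hyps(1) assms(2)] .
  then have gv: "g \<in> verts B" using step.hyps nbrs_subset_verts by blast
  have "t g \<in> nbrs B (t x)" using tree_involutionD(4)[OF assms(1) xv] step.hyps by blast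
  moreover have "t y \<in> nbrs B (t g)" using tree_involutionD(4)[OF assms(1) gv] step.hyps by blast
  ultimately show ?case using step.IH step.hyps(2) by (auto intro: reach.step)
qed (rule reach.base)

lemma reach_involution_eq:
  assumes t: "tree_involution B t" and p: "p \<in> verts B" and S: "S \<subseteq> verts B"
  shows "reach B (t ` S) (t p) = t ` reach B S p"
proof
  have "t ` t ` S = S"
    using tree_involutionD(2)[OF t] S by (force simp: image_image)
  show "reach B (t ` S) (t p) \<subseteq> t ` reach B S p"
  proof
    fix x assume x: "x \<in> reach B (t ` S) (t p)"
    have tp: "t p \<in> verts B" using tree_involutionD(1)[OF t p] .
    have "t x \<in> reach B S p"
      using reach_involution[OF t tp x] \<open>t ` t ` S = S\<close> tree_involutionD(2)[OF t p] by simp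
    moreover have "t (t x) = x" using tree_involutionD(2)[OF t] reach_in_verts[OF x tp] by blast
    ultimately show "x \<in> t ` reach B S p" by force
  qed
qed (use reach_involution[OF t p] in blast)

text \<open>Data elements are named by lines, except that the element for the line \<open>[]\<close> in the dataset of
  the node \<open>[j]\<close> is named \<open>[j]\<close>: it records the position on that line.\<close>

definition slot :: "nat \<Rightarrow> nat list \<Rightarrow> nat list" where
  "slot j g = (if g = [] then [j] else g)"

section \<open>Reading the oracle off the tree\<close>

locale encoding =
  fixes B :: nat and lines :: "nat list set" and \<iota> :: "nat list \<Rightarrow> 'u"
  assumes finite_lines: "finite lines" and lines_verts: "lines \<subseteq> verts B"
    and even_lines: "g \<in> lines \<Longrightarrow> even (length g)" and Nil_lines: "[] \<in> lines"
    and inj_names: "inj_on \<iota> ((lines - {[]}) \<union> (\<lambda>i. [i]) ` {..<B})"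
begin

definition core :: "'u fset" where
  "core = Abs_fset (\<iota> ` (lines - {[]}))"

definition dataset :: "nat \<Rightarrow> 'u fset" where
  "dataset j = finsert (\<iota> [j]) core"

definition missing :: "nat \<Rightarrow> 'u fset \<Rightarrow> nat list set" where
  "missing j z = {g \<in> lines. \<iota> (slot j g) |\<notin>| z}"

definition open_lines :: "'u fset \<Rightarrow> nat list set" where
  "open_lines z = {g \<in> lines. g \<noteq> [] \<and> \<iota> g |\<notin>| z} \<union> (if \<forall>i<B. \<iota> [i] |\<notin>| z then {[]} else {})"

text \<open>The oracle sees \<open>z\<close> but not \<open>j\<close>, so it starts from every node
  that \<open>z\<close> does not rule out. For \<open>z\<close> inside \<open>dataset j\<close> this
  is \<open>[j]\<close> alone, or all nodes of \<open>[]\<close> if the position is missing; then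
  the line \<open>[]\<close> is open and joins them.\<close>

definition region :: "'u fset \<Rightarrow> nat list set" where
  "region z = (\<Union>i\<in>{i. i < B \<and> (\<forall>i'<B. i' \<noteq> i \<longrightarrow> \<iota> [i'] |\<notin>| z)}. reach B (open_lines z) [i])"

text \<open>The default 1 keeps the values in range where the region is unusable, for instance empty
  because two positions occur in \<open>z\<close>.\<close>

definition region_max :: "(nat list \<Rightarrow> nat) \<Rightarrow> 'u fset \<Rightarrow> real" where
  "region_max v z = real (if finite (region z) \<and> region z \<noteq> {} then Suc (Max (v ` region z)) else 1)"

lemma singleton_notin_lines: "[j] \<notin> lines"
  using even_lines by fastforce

lemma fset_core: "fset core = \<iota> ` (lines - {[]})"
  using finite_lines by (simp add: core_def Abs_fset_inverse)

lemma fset_dataset: "fset (dataset j) = \<iota> ` slot j ` lines"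
  using Nil_lines by (auto simp: dataset_def fset_core slot_def image_iff)

lemma slot_in_names: "g \<in> lines \<Longrightarrow> j < B \<Longrightarrow> slot j g \<in> (lines - {[]}) \<union> (\<lambda>i. [i]) ` {..<B}"
  by (auto simp: slot_def)

lemma inj_slot: "j < B \<Longrightarrow> inj_on (\<lambda>g. \<iota> (slot j g)) lines"
proof (rule inj_onI)
  fix g g' assume j: "j < B" and g: "g \<in> lines" "g' \<in> lines" and "\<iota> (slot j g) = \<iota> (slot j g')"
  then have "slot j g = slot j g'"
    using inj_onD[OF inj_names, of "slot j g" "slot j g'"] slot_in_names[OF _ j] by simp
  then show "g = g'" using g singleton_notin_lines by (auto simp: slot_def split: if_splits)
qed

lemma name_notin_dataset:
  assumes "j < B" "i < B" "i \<noteq> j"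
  shows "\<iota> [i] |\<notin>| dataset j"
proof
  assume "\<iota> [i] |\<in>| dataset j"
  then have "\<iota> [i] \<in> \<iota> ` slot j ` lines" unfolding fset_dataset[symmetric] .
  then obtain g where g: "g \<in> lines" "\<iota> [i] = \<iota> (slot j g)" by blast
  have "[i] = slot j g"
    using inj_onD[OF inj_names g(2)] slot_in_names[OF g(1) assms(1)] assms(2) by simp
  then show False using assms(3) g(1) singleton_notin_lines by (auto simp: slot_def split: if_splits)
qed

lemma neighbors_dataset:
  assumes "j < B"
  shows "neighbors (dataset j) core"
proof -
  have "\<iota> [j] \<notin> \<iota> ` (lines - {[]})"
  proof
    assume "\<iota> [j] \<in> \<iota> ` (lines - {[]})"
    then obtain g where g: "g \<in> lines - {[]}" "\<iota> [j] = \<iota> g" by blast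
    then have "[j] = g" using inj_onD[OF inj_names, of "[j]" g] assms by blast
    then show False using g singleton_notin_lines by blast
  qed
  then have "\<iota> [j] |\<notin>| core" using fset_core by auto
  then show ?thesis by (auto simp: neighbors_def dataset_def)
qed

lemma region_eq:
  assumes j: "j < B" and z: "z |\<subseteq>| dataset j"
  shows "region z = reach B (missing j z) [j]"
proof -
  have other: "\<iota> [i] |\<notin>| z" if "i < B" "i \<noteq> j" for i
    using name_notin_dataset[OF j that] z by (meson fsubsetD)
  show ?thesis
  proof (cases "\<iota> [j] |\<in>| z")
    case True
    then have "{i. i < B \<and> (\<forall>i'<B. i' \<noteq> i \<longrightarrow> \<iota> [i'] |\<notin>| z)} = {j}" using other j by auto
    moreover have "open_lines z = missing j z"
      using True j by (auto simp: open_lines_def missing_def slot_def)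
    ultimately show ?thesis by (simp add: region_def)
  next
    case False
    then have all: "\<iota> [i] |\<notin>| z" if "i < B" for i using other that by blast
    then have S: "open_lines z = missing j z"
      using False Nil_lines by (auto simp: open_lines_def missing_def slot_def)
    have move: "[i'] \<in> reach B (missing j z) [i]" if "i < B" "i' < B" for i i'
    proof (rule reach.step[OF reach.base])
      show "[] \<in> missing j z" using False Nil_lines by (auto simp: missing_def slot_def)
    qed (use that in \<open>auto simp: nbrs_def intro: rev_image_eqI\<close>)
    have "region z = (\<Union>i<B. reach B (missing j z) [i])"
      using all by (auto simp: region_def S)
    also have "\<dots> = reach B (missing j z) [j]"
      using reach_trans move j by blast
    finally show ?thesis .
  qed
qed

lemma card_missing:
  assumes "j < B" "z \<in> DN l (dataset j)"
  shows "card (missing j z) \<le> l"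
proof -
  have "(\<lambda>g. \<iota> (slot j g)) ` missing j z \<subseteq> fset (dataset j |-| z)"
    using fset_dataset[of j] by (auto simp: missing_def)
  then have "card ((\<lambda>g. \<iota> (slot j g)) ` missing j z) \<le> card (fset (dataset j |-| z))"
    by (intro card_mono) auto
  moreover have "card ((\<lambda>g. \<iota> (slot j g)) ` missing j z) = card (missing j z)"
    by (rule card_image, rule inj_on_subset[OF inj_slot[OF assms(1)]]) (auto simp: missing_def)
  ultimately show ?thesis using assms(2) by (simp add: DN_def fcard.rep_eq)
qed

text \<open>Removing at most \<open>l\<close> elements opens at most \<open>l\<close> lines, so
  crossings never lead far from \<open>[j]\<close>.\<close>

lemma region_local:
  assumes "j < B" "z \<in> DN l (dataset j)"
  shows "region z \<subseteq> tree_ball B [j] (2 * l)" "region z \<noteq> {}"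
    and "region z = reach B (missing j z \<inter> tree_ball B [j] (2 * l - 1)) [j]"
proof -
  have eq: "region z = reach B (missing j z) [j]"
    using region_eq assms by (simp add: DN_def)
  have fin: "finite (missing j z)" using finite_lines by (simp add: missing_def)
  have loc: "x \<in> tree_ball B [j] (2 * l)" "x \<in> reach B (missing j z \<inter> tree_ball B [j] (2 * l - 1)) [j]"
    if "x \<in> region z" for x
    using reach_local[OF _ fin card_missing[OF assms], of B "[j]" x] that assms(1) eq by auto
  show "region z \<subseteq> tree_ball B [j] (2 * l)" using loc by blast
  show "region z \<noteq> {}" using reach.base[of "[j]" B] eq by blast
  show "region z = reach B (missing j z \<inter> tree_ball B [j] (2 * l - 1)) [j]"
    using loc(2) eq reach_mono[of _ B _ "[j]" "missing j z"] by blast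
qed

lemma region_max_eq:
  assumes "j < B" "z \<in> DN l (dataset j)"
  shows "region_max v z = real (Suc (Max (v ` region z)))"
  using region_local(1,2)[OF assms] finite_subset[OF _ finite_ball] by (auto simp: region_max_def)

lemma region_max_in_ball:
  assumes "j < B" "z \<in> DN l (dataset j)"
  shows "\<exists>p\<in>tree_ball B [j] (2 * l). region_max v z = real (Suc (v p))"
proof -
  have "Max (v ` region z) \<in> v ` region z"
    using region_local(1,2)[OF assms] finite_subset[OF _ finite_ball] by (intro Max_in) blast+
  then show ?thesis using region_max_eq[OF assms] region_local(1)[OF assms] by auto
qed

lemma region_subset_verts: "region z \<subseteq> verts B"
  using reach_in_verts by (auto simp: region_def)

lemma region_max_range:
  assumes "\<And>p. p \<in> verts B \<Longrightarrow> v p < r" "1 \<le> r"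
  shows "range (region_max v) \<subseteq> real ` {1..r}"
proof
  fix y assume "y \<in> range (region_max v)"
  then obtain z where y: "y = region_max v z" by blast
  show "y \<in> real ` {1..r}"
  proof (cases "finite (region z) \<and> region z \<noteq> {}")
    case True
    then have "Max (v ` region z) \<in> v ` region z" by (intro Max_in) auto
    then have "Max (v ` region z) < r" using region_subset_verts[of z] assms(1) by (metis imageE subsetD)
    then have "Suc (Max (v ` region z)) \<in> {1..r}" by simp
    moreover have "y = real (Suc (Max (v ` region z)))" using True by (simp add: y region_max_def)
    ultimately show ?thesis by blast
  qed (use assms(2) in \<open>auto simp: y region_max_def\<close>)
qed

end

text \<open>Carries the action of \<open>t\<close> on the lines in \<open>L\<close> over to the
  names used in the dataset of \<open>[j]\<close>, where \<open>[j]\<close> stands for the line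
  \<open>[]\<close>. \<open>L\<close> will be a ball about \<open>[j]\<close>, which
  \<open>t\<close> preserves.\<close>

definition rename ::
    "nat list set \<Rightarrow> nat \<Rightarrow> (nat list \<Rightarrow> nat list) \<Rightarrow> nat list \<Rightarrow> nat list" where
  "rename L j t x = (if x = [j] then slot j (t []) else if x \<in> L - {[]} then slot j (t x) else x)"

locale swapped_encoding = encoding +
  fixes l j :: nat and t :: "nat list \<Rightarrow> nat list"
  assumes j: "j < B" and l: "0 < l" and t: "tree_involution B t" "t [j] = [j]"
    and ball_lines: "tree_ball B [j] (2 * l - 1) \<subseteq> lines"
begin

definition "near = tree_ball B [j] (2 * l - 1)"

lemma near_lines: "near \<subseteq> lines"
  unfolding near_def by (rule ball_lines)

lemma Nil_near: "[] \<in> near"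
proof -
  have "2 * l - 1 = Suc (2 * (l - 1))" using l by simp
  moreover have "even (2 * (l - 1))" by simp
  ultimately show ?thesis unfolding near_def using Nil_in_ball_odd[OF j] by metis
qed

lemma t_near: "t ` near = near"
  unfolding near_def using tree_involution_ball[OF t(1) _ t(2)] j by simp

lemma t_in_near: "g \<in> near \<Longrightarrow> t g \<in> near"
  using t_near by blast

lemma t_t: "g \<in> near \<Longrightarrow> t (t g) = g"
  using tree_involutionD(2)[OF t(1)] near_lines lines_verts by blast

lemma rename_slot: "g \<in> lines \<Longrightarrow> rename near j t (slot j g) = slot j (if g \<in> near then t g else g)"
  using singleton_notin_lines[of j] Nil_near by (auto simp: rename_def slot_def)

lemma rename_involution: "rename near j t (rename near j t x) = x"
proof (cases "x \<in> slot j ` near")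
  case True
  then obtain g where g: "x = slot j g" "g \<in> near" by blast
  have "g \<in> lines" "t g \<in> lines" using g(2) t_in_near near_lines by blast+
  then have "rename near j t x = slot j (t g)" "rename near j t (slot j (t g)) = slot j (t (t g))"
    using rename_slot g t_in_near[OF g(2)] by simp_all
  then show ?thesis using t_t[OF g(2)] g(1) by simp
next
  case False
  have "x \<noteq> [j]" using False Nil_near by (force simp: slot_def)
  moreover have "x \<notin> near - {[]}" using False by (force simp: slot_def)
  ultimately have "rename near j t x = x" by (auto simp: rename_def)
  then show ?thesis by simp
qed

lemma rename_permutes: "rename near j t permutes (lines - {[]}) \<union> (\<lambda>i. [i]) ` {..<B}"
proof -
  have "rename near j t x = x" if "x \<notin> (lines - {[]}) \<union> (\<lambda>i. [i]) ` {..<B}" for x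
    using that near_lines j by (auto simp: rename_def)
  then show ?thesis unfolding permutes_def using rename_involution by metis
qed

sublocale swapped: encoding B lines "\<iota> \<circ> rename near j t"
proof unfold_locales
  show "inj_on (\<iota> \<circ> rename near j t) ((lines - {[]}) \<union> (\<lambda>i. [i]) ` {..<B})"
    by (rule comp_inj_on) (use rename_permutes inj_names in \<open>auto simp: permutes_image dest: permutes_inj_on\<close>)
qed (use finite_lines lines_verts even_lines Nil_lines in auto)

lemma slot_rename_image: "rename near j t ` slot j ` lines = slot j ` lines"
proof -
  have "rename near j t ` slot j ` lines = slot j ` (\<lambda>g. if g \<in> near then t g else g) ` lines"
    unfolding image_image by (intro image_cong refl rename_slot)
  also have "(\<lambda>g. if g \<in> near then t g else g) ` lines = lines"
  proof -
    have "g \<in> (\<lambda>g. if g \<in> near then t g else g) ` lines" if "g \<in> lines" for g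
      using that t_t[of g] t_in_near[of g] near_lines by (intro image_eqI[of _ _ "if g \<in> near then t g else g"]) auto
    then show ?thesis using t_in_near near_lines by auto
  qed
  finally show ?thesis .
qed

lemma dataset_swapped: "swapped.dataset j = dataset j"
proof -
  have "fset (swapped.dataset j) = fset (dataset j)"
    unfolding fset_dataset swapped.fset_dataset image_comp[symmetric] slot_rename_image ..
  then show ?thesis by (simp add: fset_inject)
qed

text \<open>Renaming moves the missing lines near \<open>[j]\<close>, and with them the region, by
  \<open>t\<close>; \<open>v'\<close> undoes the move. No permitted query tells the two oracles
  apart.\<close>

lemma region_max_swapped:
  assumes z: "z \<in> DN l (dataset j)" and v: "\<And>p. p \<in> tree_ball B [j] (2 * l) \<Longrightarrow> v' p = v (t p)"
  shows "swapped.region_max v' z = region_max v z"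
proof -
  have z': "z \<in> DN l (swapped.dataset j)" using z dataset_swapped by simp
  have "swapped.missing j z \<inter> near = t ` (missing j z \<inter> near)"
  proof -
    have "g \<in> swapped.missing j z \<longleftrightarrow> t g \<in> missing j z" if "g \<in> near" for g
    proof -
      have "g \<in> lines" "t g \<in> lines" using that near_lines t_in_near by blast+
      then show ?thesis using that rename_slot[of g] by (simp add: swapped.missing_def missing_def)
    qed
    moreover have "g = t (t g) \<and> t g \<in> near" if "g \<in> near" for g using that t_t t_in_near by simp
    ultimately show ?thesis by (auto simp: image_iff)
  qed
  moreover have "missing j z \<inter> near \<subseteq> verts B" using lines_verts by (auto simp: missing_def)
  ultimately have reg: "swapped.region z = t ` region z"
    using region_local(3)[OF j z] swapped.region_local(3)[OF j z'] t(2)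
      reach_involution_eq[OF t(1), of "[j]" "missing j z \<inter> near"] j by (simp add: near_def)
  have "v' ` t ` region z = v ` region z"
  proof -
    have "v' (t p) = v p" if "p \<in> region z" for p
    proof -
      have p: "p \<in> tree_ball B [j] (2 * l)" using region_local(1)[OF j z] that by blast
      then have "t p \<in> tree_ball B [j] (2 * l)"
        using tree_involution_ball[OF t(1) _ t(2), of "2 * l"] j by auto
      moreover have "t (t p) = p" using tree_involutionD(2)[OF t(1)] region_subset_verts that by blast
      ultimately show ?thesis using v by metis
    qed
    then show ?thesis by (auto simp: image_iff)
  qed
  then show ?thesis using reg region_max_eq[OF j z] swapped.region_max_eq[OF j z'] by simp
qed

end

section \<open>The averaging argument\<close>

lemma run_cong: "(\<And>z. z \<in> queried t f \<Longrightarrow> f z = g z) \<Longrightarrow> run t f = run t g"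
  by (induction t) auto

lemma output_dist_cong:
  assumes "randomized_algorithm W" "down_local l W" "\<And>z. z \<in> DN l x \<Longrightarrow> f z = g z"
  shows "output_dist W f x = output_dist W g x"
  unfolding output_dist_def
proof (rule distr_cong_AE[OF refl refl])
  have "AE t in W x. \<forall>f. queried t f \<subseteq> DN l x" using assms(2) by (simp add: down_local_def)
  then show "AE t in W x. run t f = run t g"
    by eventually_elim (rule run_cong, use assms(3) in blast)
qed (use assms(1) in \<open>auto simp: randomized_algorithm_def\<close>)

lemma prob_space_output_dist: "randomized_algorithm W \<Longrightarrow> prob_space (output_dist W f x)"
  unfolding output_dist_def randomized_algorithm_def by (intro prob_space.prob_space_distr) auto

lemma sets_output_dist [simp]: "sets (output_dist W f x) = sets output_space"
  and space_output_dist [simp]: "space (output_dist W f x) = UNIV"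
  by (simp_all add: output_dist_def)

text \<open>The sum is the expected number of events that occur.\<close>

lemma (in prob_space) sum_prob_le:
  assumes "finite I" "\<And>i. i \<in> I \<Longrightarrow> A i \<in> events" "\<And>x. x \<in> space M \<Longrightarrow> card {i \<in> I. x \<in> A i} \<le> c"
  shows "(\<Sum>i\<in>I. prob (A i)) \<le> real c"
proof -
  have "(\<Sum>i\<in>I. prob (A i)) = (\<Sum>i\<in>I. \<integral>x. indicator (A i) x \<partial>M)"
    using assms(2) by (intro sum.cong refl) (simp add: Int_absorb1 sets.sets_into_space)
  also have "\<dots> = (\<integral>x. (\<Sum>i\<in>I. indicator (A i) x) \<partial>M)"
    using assms(2) by (intro Bochner_Integration.integral_sum[symmetric]) (auto simp: emeasure_eq_measure)
  also have "\<dots> \<le> (\<integral>x. real c \<partial>M)"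
  proof (rule integral_mono)
    fix x assume x: "x \<in> space M"
    have "(\<Sum>i\<in>I. indicator (A i) x) = real (card {i \<in> I. x \<in> A i})"
      using assms(1) by (simp add: indicator_def sum.If_cases Int_def)
    then show "(\<Sum>i\<in>I. indicator (A i) x) \<le> real c" using assms(3)[OF x] by simp
  qed (use assms(2) in \<open>auto simp: emeasure_eq_measure\<close>)
  finally show ?thesis by (simp add: prob_space)
qed

text \<open>Values are shifted by one because a \<^const>\<open>interior_accurate\<close> wrapper expects \<open>f\<close> to start at 1.\<close>

definition outcome :: "(nat \<Rightarrow> bool) \<Rightarrow> real option set" where
  "outcome P = {y. \<exists>w. y = Some w \<and> P (nat \<lfloor>w - 1\<rfloor>)}"

lemma outcome_sets: "outcome P \<in> sets output_space"
proof -
  have "(\<lambda>w::real. \<lfloor>w - 1\<rfloor>) \<in> measurable borel (count_space UNIV)" by measurable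
  then have "(\<lambda>w::real. \<lfloor>w - 1\<rfloor>) -` {n. P (nat n)} \<inter> space borel \<in> sets borel"
    by (rule measurable_sets) simp
  moreover have "Some -` outcome P = (\<lambda>w::real. \<lfloor>w - 1\<rfloor>) -` {n. P (nat n)} \<inter> space borel"
    by (auto simp: outcome_def)
  ultimately show ?thesis by (simp add: sets_output_space)
qed

lemma finite_DN: "finite (DN l x)"
proof (rule finite_subset)
  show "DN l x \<subseteq> fset (fPow x)" by (auto simp: DN_def)
qed simp

lemma self_in_DN: "x \<in> DN l x"
  by (simp add: DN_def fcard.rep_eq)

lemma length_ball: "q \<in> tree_ball B p k \<Longrightarrow> length q \<le> length p + k"
proof (induction k arbitrary: q)
  case (Suc k)
  then obtain q' i where "q' \<in> tree_ball B p k" "q = flip i q'" by (auto simp: nbrs_def)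
  moreover have "length (flip i q') \<le> Suc (length q')" by (cases q') auto
  ultimately show ?case using Suc.IH[of q'] by simp
qed simp

lemma bij_betw_comp_permutes:
  assumes "finite A" "\<pi> permutes A"
  shows "bij_betw (\<lambda>\<sigma>. \<sigma> \<circ> \<pi>) {\<sigma>. \<sigma> permutes A} {\<sigma>. \<sigma> permutes A}"
proof -
  have "surj \<pi>" using assms(2) by (rule permutes_surj)
  then have inj: "inj_on (\<lambda>\<sigma>. \<sigma> \<circ> \<pi>) {\<sigma>. \<sigma> permutes A}"
    by (intro inj_onI) (metis comp_apply ext surjD)
  have "(\<lambda>\<sigma>. \<sigma> \<circ> \<pi>) ` {\<sigma>. \<sigma> permutes A} \<subseteq> {\<sigma>. \<sigma> permutes A}"
    using permutes_compose[OF assms(2)] by auto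
  then have "(\<lambda>\<sigma>. \<sigma> \<circ> \<pi>) ` {\<sigma>. \<sigma> permutes A} = {\<sigma>. \<sigma> permutes A}"
    by (intro endo_inj_surj finite_permutations assms inj)
  with inj show ?thesis by (simp add: bij_betw_def)
qed

lemma card_nbrs: "card (nbrs B p) = B"
  unfolding nbrs_def by (subst card_image) (auto simp: inj_on_def flip_eq_iff)

section \<open>The wrapper in a random world\<close>

locale accurate_wrapper =
  fixes W :: "'u randomized_alg" and l r B :: nat and \<epsilon> \<delta> \<beta> :: real and \<iota>0 :: "nat list \<Rightarrow> 'u"
  assumes B: "0 < B" and r: "level B (2 * l) \<le> r" and inj_\<iota>0: "inj \<iota>0"
    and wrapper: "privacy_wrapper \<epsilon> \<delta> W" and downward: "down_local l W"
    and accurate: "interior_accurate r \<beta> l W"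
begin

text \<open>Independent of \<open>j\<close>, yet for \<open>0 < l\<close> it contains the ball of
  radius \<open>2 * l - 1\<close> about every node \<open>[j]\<close>, whose centre has length
  1.\<close>

definition lines :: "nat list set" where
  "lines = {g \<in> verts B. even (length g) \<and> length g \<le> 2 * l}"

definition names :: "nat list set" where
  "names = (lines - {[]}) \<union> (\<lambda>i. [i]) ` {..<B}"

lemma randomized: "randomized_algorithm W"
  using wrapper by (simp add: privacy_wrapper_def)

lemma finite_lines: "finite lines"
proof (rule finite_subset)
  show "lines \<subseteq> {xs. set xs \<subseteq> {..<B} \<and> length xs \<le> 2 * l}" by (auto simp: lines_def verts_def)
qed (rule finite_lists_length_le, simp)

lemma finite_names: "finite names"
  using finite_lines by (simp add: names_def)

lemma permutations_nonempty: "{\<sigma>. \<sigma> permutes names} \<noteq> {}"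
proof -
  have "id \<in> {\<sigma>. \<sigma> permutes names}" using permutes_id by simp
  then show ?thesis by blast
qed

lemma encoding: "\<sigma> permutes names \<Longrightarrow> encoding B lines (\<iota>0 \<circ> \<sigma>)"
  using finite_lines permutes_inj[of \<sigma> names] inj_\<iota>0
  by unfold_locales (auto simp: lines_def inj_on_def dest: injD)

definition func :: "(nat \<Rightarrow> nat list \<Rightarrow> nat) \<times> (nat list \<Rightarrow> nat list) \<Rightarrow> 'u fset \<Rightarrow> real" where
  "func = (\<lambda>(h, \<sigma>). encoding.region_max B lines (\<iota>0 \<circ> \<sigma>) (h (2 * l)))"

definition large :: "(nat \<Rightarrow> nat list \<Rightarrow> nat) \<times> (nat list \<Rightarrow> nat list) \<Rightarrow> nat \<Rightarrow> 'u fset" where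
  "large = (\<lambda>(h, \<sigma>) j. encoding.dataset lines (\<iota>0 \<circ> \<sigma>) j)"

definition small :: "(nat \<Rightarrow> nat list \<Rightarrow> nat) \<times> (nat list \<Rightarrow> nat list) \<Rightarrow> 'u fset" where
  "small = (\<lambda>(h, \<sigma>). encoding.core lines (\<iota>0 \<circ> \<sigma>))"

definition prob_caught ::
    "nat \<Rightarrow> nat list \<Rightarrow> (nat \<Rightarrow> nat list \<Rightarrow> nat) \<times> (nat list \<Rightarrow> nat list) \<Rightarrow> real" where
  "prob_caught j g \<omega> =
     measure (output_dist W (func \<omega>) (large \<omega> j)) (outcome (caught B (fst \<omega>) j g (2 * l)))"

definition worlds :: "((nat \<Rightarrow> nat list \<Rightarrow> nat) \<times> (nat list \<Rightarrow> nat list)) pmf" where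
  "worlds = pair_pmf (history_pmf B (2 * l)) (pmf_of_set {\<sigma>. \<sigma> permutes names})"

lemma worldsD:
  assumes "(h, \<sigma>) \<in> set_pmf worlds"
  shows "valid_history B (2 * l) h" "\<sigma> permutes names"
proof -
  show "valid_history B (2 * l) h" "\<sigma> permutes names"
    using assms permutations_nonempty valid_history_pmf[OF B] finite_permutations[OF finite_names]
    by (auto simp: worlds_def set_pmf_of_set)
qed

lemma prob_le_1: "measure (output_dist W f x) E \<le> 1"
  using prob_space.prob_le_1[OF prob_space_output_dist[OF randomized]] .

text \<open>Accuracy brackets the output between two answers, which come from values in the ball
  about \<open>[j]\<close>. Rounding down keeps the bracket because the answers are
  integers.\<close>

lemma hit_caught_ge:
  assumes \<omega>: "\<omega> \<in> set_pmf worlds" and j: "j < B"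
  shows "1 - \<beta> \<le> measure (output_dist W (func \<omega>) (large \<omega> j)) (outcome (hit B (fst \<omega>) j (2 * l))) +
    prob_caught j [] \<omega>"
proof -
  obtain h \<sigma> where hs: "\<omega> = (h, \<sigma>)" by (cases \<omega>)
  have valid: "valid_history B (2 * l) h" and \<sigma>: "\<sigma> permutes names" using worldsD \<omega> hs by auto
  interpret encoding B lines "\<iota>0 \<circ> \<sigma>" by (rule encoding[OF \<sigma>])
  define f where "f = region_max (h (2 * l))"
  define Y where "Y = dataset j"
  let ?P = "output_dist W f Y"
  interpret P: prob_space ?P by (rule prob_space_output_dist[OF randomized])
  have vr: "h (2 * l) p < r" if "p \<in> verts B" for p
  proof -
    have "h (2 * l) p < level B (2 * l)" using valid that by (simp add: valid_history_def)
    then show ?thesis using r by simp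
  qed
  then have "1 \<le> r" using Nil_in_verts[of B] by fastforce
  then have "range f \<subseteq> real ` {1..r}"
    unfolding f_def by (intro region_max_range vr)
  then have acc: "1 - \<beta> \<le> measure ?P (Some ` {Min (f ` DN l Y)..Max (f ` DN l Y)})"
    using accurate by (simp add: interior_accurate_def)
  have fin: "finite (f ` DN l Y)" "f ` DN l Y \<noteq> {}" using finite_DN self_in_DN by blast+
  obtain z z' where z: "z \<in> DN l Y" "Min (f ` DN l Y) = f z" "z' \<in> DN l Y" "Max (f ` DN l Y) = f z'"
    using Min_in[OF fin] Max_in[OF fin] by auto
  obtain p p' where p: "p \<in> tree_ball B [j] (2 * l)" "f z = real (Suc (h (2 * l) p))"
      "p' \<in> tree_ball B [j] (2 * l)" "f z' = real (Suc (h (2 * l) p'))"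
    using region_max_in_ball[OF j, of _ l "h (2 * l)"] z unfolding f_def Y_def by metis
  have "Some ` {Min (f ` DN l Y)..Max (f ` DN l Y)} \<subseteq>
      outcome (hit B h j (2 * l)) \<union> outcome (caught B h j [] (2 * l))"
  proof
    fix y assume "y \<in> Some ` {Min (f ` DN l Y)..Max (f ` DN l Y)}"
    then obtain w where w: "y = Some w" "real (Suc (h (2 * l) p)) \<le> w" "w \<le> real (Suc (h (2 * l) p'))"
      using z p by auto
    then have "h (2 * l) p \<le> nat \<lfloor>w - 1\<rfloor>" "nat \<lfloor>w - 1\<rfloor> \<le> h (2 * l) p'"
      by (auto simp: le_nat_floor) linarith+
    then have "hit B h j (2 * l) (nat \<lfloor>w - 1\<rfloor>) \<or> caught B h j [] (2 * l) (nat \<lfloor>w - 1\<rfloor>)"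
      using hit_or_caught[OF valid j, of "2 * l"] p by auto
    then show "y \<in> outcome (hit B h j (2 * l)) \<union> outcome (caught B h j [] (2 * l))"
      by (auto simp: outcome_def w)
  qed
  then have "measure ?P (Some ` {Min (f ` DN l Y)..Max (f ` DN l Y)}) \<le>
      measure ?P (outcome (hit B h j (2 * l)) \<union> outcome (caught B h j [] (2 * l)))"
    using outcome_sets by (intro P.finite_measure_mono) auto
  also have "\<dots> \<le> measure ?P (outcome (hit B h j (2 * l))) + measure ?P (outcome (caught B h j [] (2 * l)))"
    using outcome_sets by (intro measure_Un_le) auto
  finally show ?thesis
    using acc by (simp add: prob_caught_def func_def large_def hs f_def Y_def)
qed

text \<open>The only comparison of neighbouring datasets: for each node the event \<open>hit\<close>
  is moved to the small dataset, where all nodes share one output distribution and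
  \<open>card_hit\<close> applies.\<close>

lemma sum_caught_ge:
  assumes \<omega>: "\<omega> \<in> set_pmf worlds"
  shows "real B * (1 - \<beta> - \<delta>) \<le> exp \<epsilon> * real (Suc l) + (\<Sum>j<B. prob_caught j [] \<omega>)"
proof -
  obtain h \<sigma> where hs: "\<omega> = (h, \<sigma>)" by (cases \<omega>)
  have valid: "valid_history B (2 * l) h" and \<sigma>: "\<sigma> permutes names" using worldsD \<omega> hs by auto
  interpret encoding B lines "\<iota>0 \<circ> \<sigma>" by (rule encoding[OF \<sigma>])
  let ?hit = "\<lambda>x j. measure (output_dist W (func \<omega>) x) (outcome (hit B h j (2 * l)))"
  interpret P: prob_space "output_dist W (func \<omega>) (small \<omega>)"
    by (rule prob_space_output_dist[OF randomized])
  have "(\<Sum>j<B. ?hit (small \<omega>) j) \<le> real (Suc l)"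
  proof (rule P.sum_prob_le)
    fix y
    show "card {j \<in> {..<B}. y \<in> outcome (hit B h j (2 * l))} \<le> Suc l"
    proof (cases y)
      case (Some w)
      then show ?thesis using card_hit[OF valid, of "2 * l" "nat \<lfloor>w - 1\<rfloor>"] by (simp add: outcome_def)
    qed (simp add: outcome_def)
  qed (use outcome_sets in auto)
  have dp: "?hit (large \<omega> j) j \<le> exp \<epsilon> * ?hit (small \<omega>) j + \<delta>" if "j < B" for j
    using wrapper neighbors_dataset[OF that] outcome_sets
    by (auto simp: privacy_wrapper_def differentially_private_def large_def small_def hs)
  have "1 - \<beta> - \<delta> \<le> exp \<epsilon> * ?hit (small \<omega>) j + prob_caught j [] \<omega>" if "j < B" for j
    using hit_caught_ge[OF \<omega> that] dp[OF that] by (simp add: hs)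
  then have "(\<Sum>j<B. 1 - \<beta> - \<delta>) \<le> (\<Sum>j<B. exp \<epsilon> * ?hit (small \<omega>) j + prob_caught j [] \<omega>)"
    by (intro sum_mono) simp
  also have "\<dots> = exp \<epsilon> * (\<Sum>j<B. ?hit (small \<omega>) j) + (\<Sum>j<B. prob_caught j [] \<omega>)"
    by (simp add: sum.distrib sum_distrib_left)
  also have "\<dots> \<le> exp \<epsilon> * real (Suc l) + (\<Sum>j<B. prob_caught j [] \<omega>)"
    using \<open>(\<Sum>j<B. ?hit (small \<omega>) j) \<le> real (Suc l)\<close> by simp
  finally show ?thesis by simp
qed

lemma sum_nbrs_caught_le:
  assumes \<omega>: "\<omega> \<in> set_pmf worlds" and j: "j < B"
  shows "(\<Sum>g\<in>nbrs B [j]. prob_caught j g \<omega>) \<le> real l"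
proof -
  obtain h \<sigma> where hs: "\<omega> = (h, \<sigma>)" by (cases \<omega>)
  have valid: "valid_history B (2 * l) h" using worldsD \<omega> hs by auto
  interpret P: prob_space "output_dist W (func \<omega>) (large \<omega> j)"
    by (rule prob_space_output_dist[OF randomized])
  show ?thesis unfolding prob_caught_def
  proof (rule P.sum_prob_le)
    fix y
    show "card {g \<in> nbrs B [j]. y \<in> outcome (caught B (fst \<omega>) j g (2 * l))} \<le> l"
    proof (cases y)
      case (Some w)
      then show ?thesis
        using card_caught[OF valid _ j, of "2 * l" "nat \<lfloor>w - 1\<rfloor>"] by (simp add: outcome_def hs)
    qed (simp add: outcome_def)
  qed (use outcome_sets in auto)
qed

lemma near_lines:
  assumes "j < B" "0 < l"
  shows "tree_ball B [j] (2 * l - 1) \<subseteq> lines"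
proof
  fix g assume g: "g \<in> tree_ball B [j] (2 * l - 1)"
  have "g \<in> verts B" using g ball_subset_verts[of "[j]" B] assms by auto
  moreover have "even (length g)" using even_length_ball[OF g] assms by simp
  moreover have "length g \<le> 2 * l" using length_ball[OF g] assms by simp
  ultimately show "g \<in> lines" by (simp add: lines_def)
qed

text \<open>Both worlds present the same dataset and the same answers to all permitted queries, so
  the outputs have the same law. Only the line in the role of \<open>[]\<close> differs.\<close>

lemma prob_caught_swapped:
  assumes l: "0 < l" and j: "j < B" and t: "tree_involution B t" "t [j] = [j]"
    and \<omega>: "(h, \<sigma>) \<in> set_pmf worlds"
  shows "prob_caught j [] (local_history B j (2 * l) (\<lambda>i p. h i (t p)),
      \<sigma> \<circ> rename (tree_ball B [j] (2 * l - 1)) j t) = prob_caught j (t []) (h, \<sigma>)"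
proof -
  let ?\<omega> = "(local_history B j (2 * l) (\<lambda>i p. h i (t p)), \<sigma> \<circ> rename (tree_ball B [j] (2 * l - 1)) j t)"
  note valid = worldsD(1)[OF \<omega>] and \<sigma> = worldsD(2)[OF \<omega>]
  interpret encoding B lines "\<iota>0 \<circ> \<sigma>" by (rule encoding[OF \<sigma>])
  interpret swapped_encoding B lines "\<iota>0 \<circ> \<sigma>" l j t
    by unfold_locales (rule j l t near_lines[OF j l])+
  have lh: "local_history B j (2 * l) (\<lambda>i p. h i (t p)) i p = h i (t p)"
    if "i \<le> 2 * l" "p \<in> tree_ball B [j] i" for i p
    using that by (simp add: local_history_def)
  have large: "large ?\<omega> j = large (h, \<sigma>) j"
    using dataset_swapped by (simp add: large_def near_def comp_assoc)
  have "func ?\<omega> z = func (h, \<sigma>) z" if "z \<in> DN l (large (h, \<sigma>) j)" for z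
    using region_max_swapped[of z "local_history B j (2 * l) (\<lambda>i p. h i (t p)) (2 * l)" "h (2 * l)"] that lh
    by (simp add: func_def large_def near_def comp_assoc)
  then have "output_dist W (func ?\<omega>) (large ?\<omega> j) = output_dist W (func (h, \<sigma>)) (large (h, \<sigma>) j)"
    unfolding large by (rule output_dist_cong[OF randomized downward])
  moreover have "caught B (fst ?\<omega>) j [] (2 * l) = caught B h j (t []) (2 * l)"
    using caught_involution[OF valid j t, of "fst ?\<omega>" "2 * l"] lh by (simp add: fun_eq_iff)
  ultimately show ?thesis by (simp add: prob_caught_def)
qed

lemma integrable_prob_caught: "integrable worlds (\<lambda>\<omega>. prob_caught j g (F \<omega>))"
  by (rule measure_pmf.integrable_const_bound[of _ 1]) (auto simp: prob_caught_def prob_le_1)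

text \<open>Exchangeability: random isometries and random names make the lines of \<open>[j]\<close>
  indistinguishable on average.\<close>

lemma expectation_caught_eq:
  assumes j: "j < B" and g: "g \<in> nbrs B [j]"
  shows "(\<integral>\<omega>. prob_caught j g \<omega> \<partial>worlds) = (\<integral>\<omega>. prob_caught j [] \<omega> \<partial>worlds)"
proof (cases "l = 0")
  case True
  then have "\<not> caught B h j g' (2 * l) w" for h g' w by simp
  then have "outcome (caught B h j g' (2 * l)) = {}" for h g' by (simp add: outcome_def)
  then have "prob_caught j g' \<omega> = 0" for g' \<omega> by (simp add: prob_caught_def)
  then show ?thesis by (simp only:)
next
  case False
  then have l: "0 < l" by simp
  obtain i where i: "i < B" "g = flip i [j]" using g by (auto simp: nbrs_def)
  let ?near = "tree_ball B [j] (2 * l - 1)"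
  let ?F = "\<lambda>t. map_prod (\<lambda>h. local_history B j (2 * l) (\<lambda>i p. h i (t p))) (\<lambda>\<sigma>. \<sigma> \<circ> rename ?near j t)"
  have eq: "map_pmf (?F t) worlds =
      pair_pmf (map_pmf (local_history B j (2 * l)) (history_pmf B (2 * l))) (pmf_of_set {\<sigma>. \<sigma> permutes names})"
    if t: "tree_involution B t" "t [j] = [j]" for t
  proof -
    \<comment> \<open>Any encoding serves here; it only supplies the fact that \<open>rename\<close>
      permutes the names.\<close>
    interpret encoding B lines "\<iota>0 \<circ> id" by (rule encoding[OF permutes_id])
    interpret swapped_encoding B lines "\<iota>0 \<circ> id" l j t
      by unfold_locales (rule j l t near_lines[OF j l])+
    have "rename ?near j t permutes names"
      using rename_permutes by (simp add: names_def near_def)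
    then have "map_pmf (\<lambda>\<sigma>. \<sigma> \<circ> rename ?near j t) (pmf_of_set {\<sigma>. \<sigma> permutes names}) =
        pmf_of_set {\<sigma>. \<sigma> permutes names}"
      by (intro map_pmf_of_set_bij_betw bij_betw_comp_permutes finite_names finite_permutations
          permutations_nonempty)
    then show ?thesis
      unfolding worlds_def map_prod_def map_pair local_history_invariant[OF B j t] by simp
  qed
  have expect: "(\<integral>\<omega>. prob_caught j (t []) \<omega> \<partial>worlds) = (\<integral>\<omega>. prob_caught j [] \<omega> \<partial>map_pmf (?F t) worlds)"
    if t: "tree_involution B t" "t [j] = [j]" for t
  proof -
    have "prob_caught j (t []) \<omega> = prob_caught j [] (?F t \<omega>)" if "\<omega> \<in> set_pmf worlds" for \<omega>
      using prob_caught_swapped[OF l j t, of "fst \<omega>" "snd \<omega>"] that by (cases \<omega>) simp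
    then show ?thesis unfolding integral_map_pmf
      by (intro integral_cong_AE) (auto simp: AE_measure_pmf_iff)
  qed
  obtain t where t: "tree_involution B t" "t [j] = [j]" "t [] = g"
    using ex_tree_involution[OF i(1) j] i(2) by blast
  have "(\<integral>\<omega>. prob_caught j g \<omega> \<partial>worlds) = (\<integral>\<omega>. prob_caught j [] \<omega> \<partial>map_pmf (?F t) worlds)"
    using expect[OF t(1,2)] t(3) by simp
  \<comment> \<open>The transformed law is the same for all \<open>t\<close>. Passing through the
    identity accounts for the truncation in \<open>local_history\<close>.\<close>
  also have "\<dots> = (\<integral>\<omega>. prob_caught j [] \<omega> \<partial>map_pmf (?F (\<lambda>p. p)) worlds)"
    unfolding eq[OF t(1,2)] eq[OF tree_involution_id refl] ..
  also have "\<dots> = (\<integral>\<omega>. prob_caught j [] \<omega> \<partial>worlds)"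
    using expect[OF tree_involution_id refl] by simp
  finally show ?thesis .
qed

lemma expectation_caught_le:
  assumes j: "j < B"
  shows "real B * (\<integral>\<omega>. prob_caught j [] \<omega> \<partial>worlds) \<le> real l"
proof -
  have "real B * (\<integral>\<omega>. prob_caught j [] \<omega> \<partial>worlds) = (\<Sum>g\<in>nbrs B [j]. \<integral>\<omega>. prob_caught j g \<omega> \<partial>worlds)"
    using expectation_caught_eq[OF j] by (simp add: card_nbrs)
  also have "\<dots> = (\<integral>\<omega>. (\<Sum>g\<in>nbrs B [j]. prob_caught j g \<omega>) \<partial>worlds)"
    using integrable_prob_caught[of j _ "\<lambda>\<omega>. \<omega>"] by (intro Bochner_Integration.integral_sum[symmetric]) simp
  also have "\<dots> \<le> (\<integral>\<omega>. real l \<partial>worlds)"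
    using sum_nbrs_caught_le[OF _ j] integrable_prob_caught[of j _ "\<lambda>\<omega>. \<omega>"]
    by (intro integral_mono_AE) (auto simp: AE_measure_pmf_iff)
  finally show ?thesis by simp
qed

text \<open>Averaging \<open>sum_caught_ge\<close> over the worlds, where each of the
  \<open>B\<close> nodes contributes at most \<open>l / B\<close>.\<close>

lemma degree_bound: "real B * (1 - \<beta> - \<delta>) \<le> exp \<epsilon> * real (Suc l) + real l"
proof -
  have int: "integrable worlds (\<lambda>\<omega>. prob_caught j [] \<omega>)" for j
    using integrable_prob_caught[of j _ "\<lambda>\<omega>. \<omega>"] by simp
  have "(\<integral>\<omega>. real B * (1 - \<beta> - \<delta>) \<partial>worlds) \<le>
      (\<integral>\<omega>. exp \<epsilon> * real (Suc l) + (\<Sum>j<B. prob_caught j [] \<omega>) \<partial>worlds)"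
    using sum_caught_ge int by (intro integral_mono_AE) (auto simp: AE_measure_pmf_iff)
  then have "real B * (1 - \<beta> - \<delta>) \<le>
      exp \<epsilon> * real (Suc l) + (\<Sum>j<B. \<integral>\<omega>. prob_caught j [] \<omega> \<partial>worlds)"
    using int by (simp add: Bochner_Integration.integral_add Bochner_Integration.integral_sum)
  also have "(\<Sum>j<B. \<integral>\<omega>. prob_caught j [] \<omega> \<partial>worlds) \<le> (\<Sum>j<B. real l / real B)"
    using expectation_caught_le B by (intro sum_mono) (simp add: field_simps)
  also have "(\<Sum>j<B. real l / real B) = real l" using B by simp
  finally show ?thesis by simp
qed

end

section \<open>Towers\<close>

lemma log_star_mono: "x \<le> y \<Longrightarrow> log_star x \<le> log_star y"
proof (induction "log_star y" arbitrary: x y)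
  case 0
  have "y \<le> 1" using 0(1) log_star_gt_1[of y] by linarith
  then show ?case using 0 log_star_le_1[of x] by simp
next
  case (Suc n)
  show ?case
  proof (cases "x \<le> 1")
    case False
    then have "n = log_star (log 2 y)" using Suc(2,3) log_star_gt_1[of y] by simp
    moreover have "log 2 x \<le> log 2 y" using False Suc(3) by simp
    ultimately have "log_star (log 2 x) \<le> log_star (log 2 y)" by (rule Suc(1))
    then show ?thesis using False Suc(3) log_star_gt_1[of x] log_star_gt_1[of y] by simp
  qed (simp add: log_star_le_1)
qed

lemma log_star_power_2: "log_star (2 ^ n) = (if n = 0 then 0 else Suc (log_star (real n)))"
  using log_star_gt_1[of "2 ^ n"] by (simp add: log_star_le_1 log_nat_power)

lemma log_star_le_nat: "x \<le> real n \<Longrightarrow> log_star x \<le> n"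
proof (induction n arbitrary: x)
  case (Suc n)
  show ?case
  proof (cases "x \<le> 1")
    case False
    have "Suc n \<le> 2 ^ n" by (simp add: Suc_leI)
    then have "real (Suc n) \<le> 2 ^ n" by (metis of_nat_le_iff of_nat_numeral of_nat_power)
    then have "log 2 x \<le> real n" using Suc.prems False by (simp add: log_le_iff powr_realpow)
    then show ?thesis using Suc.IH[of "log 2 x"] False log_star_gt_1[of x] by simp
  qed (simp add: log_star_le_1)
qed (simp add: log_star_le_1)

lemma log_star_unbounded: "\<exists>x0. \<forall>x\<ge>x0. N \<le> log_star x"
proof (induction N)
  case (Suc N)
  then obtain x0 where x0: "\<And>x. x0 \<le> x \<Longrightarrow> N \<le> log_star x" by blast
  have "Suc N \<le> log_star x" if x: "max 2 (2 powr x0) \<le> x" for x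
  proof -
    have "x0 \<le> log 2 x" using x by (simp add: le_log_iff)
    then show ?thesis using x0 x log_star_gt_1[of x] by simp
  qed
  then show ?case by blast
qed simp

lemma level_ge: "0 < B \<Longrightarrow> B \<le> level B k"
  using level_pos[of B] by (cases k) (auto intro: self_le_power)

lemma square_le_power_2: "4 \<le> n \<Longrightarrow> n * n \<le> (2::nat) ^ n"
proof (induction n rule: dec_induct)
  case (step n)
  have "Suc n * Suc n \<le> n * n + 3 * n" using step by simp
  also have "\<dots> \<le> 2 * (n * n)" using step by simp
  finally show ?case using step by simp
qed simp

text \<open>With \<open>L = level B k\<close>, one level costs at most two exponentials:
  \<open>B ^ L \<le> L ^ L \<le> 2 ^ 2 ^ L\<close>.\<close>

lemma log_star_level:
  assumes "4 \<le> B"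
  shows "log_star (real (level B k)) \<le> 2 * k + log_star (real B)"
proof (induction k)
  case (Suc k)
  let ?L = "level B k"
  have L: "B \<le> ?L" using level_ge assms by simp
  have "B ^ ?L \<le> ?L ^ ?L" using L by (intro power_mono) auto
  also have "\<dots> \<le> (2 ^ ?L) ^ ?L" by (intro power_mono) (auto intro: less_imp_le)
  also have "\<dots> = 2 ^ (?L * ?L)" by (simp add: power_mult)
  also have "\<dots> \<le> 2 ^ 2 ^ ?L" using L assms by (intro power_increasing square_le_power_2) auto
  finally have "real (B ^ ?L) \<le> real (2 ^ 2 ^ ?L)" by (rule of_nat_mono)
  then have "log_star (real (B ^ ?L)) \<le> log_star (2 ^ 2 ^ ?L)" by (intro log_star_mono) simp
  also have "\<dots> = Suc (log_star (2 ^ ?L))" using log_star_power_2[of "2 ^ ?L"] by simp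
  also have "\<dots> = Suc (Suc (log_star (real ?L)))" using log_star_power_2[of ?L] L assms by simp
  finally show ?case using Suc by simp
qed simp

text \<open>A crude bound: the contribution of the degree only has to be linear in
  \<open>l\<close>.\<close>

lemma log_star_mult_le:
  assumes "0 < C"
  shows "log_star (real (C * Suc l)) \<le> Suc (C + l)"
proof (cases "real (C * Suc l) \<le> 1")
  case False
  have "Suc l \<le> 2 ^ l" "C \<le> 2 ^ C" by (auto simp: Suc_leI less_imp_le)
  then have "C * Suc l \<le> 2 ^ C * 2 ^ l" by (rule mult_le_mono[rotated])
  then have "real (C * Suc l) \<le> real (2 ^ (C + l))" by (intro of_nat_mono) (simp add: power_add)
  then have "log_star (real (C * Suc l)) \<le> log_star (2 ^ (C + l))" by (intro log_star_mono) simp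
  also have "\<dots> \<le> Suc (log_star (real (C + l)))" by (simp only: log_star_power_2) simp
  also have "\<dots> \<le> Suc (C + l)" using log_star_le_nat[of "real (C + l)" "C + l"] by simp
  finally show ?thesis .
qed (simp add: log_star_le_1)

theorem theorem5p3:
  fixes \<epsilon> \<delta> \<beta> :: real
  assumes "countable (UNIV :: 'u set)" and "infinite (UNIV :: 'u set)"
    and "0 < \<epsilon>" "\<epsilon> < 1"
    and "0 < \<delta>" "\<delta> < 1"
    and "0 < \<beta>" "\<beta> < 1"
    and "\<delta> + \<beta> < 1"
  shows "\<exists>c > 0. \<forall>\<^sub>F r in sequentially. \<forall>(W :: 'u randomized_alg) l.
           privacy_wrapper \<epsilon> \<delta> W \<longrightarrow> down_local l W \<longrightarrow> interior_accurate r \<beta> l W \<longrightarrow>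
             real l \<ge> c * real (log_star (real r))"
proof -
  \<comment> \<open>With degree \<open>C * Suc l\<close> the left side of
    \<open>degree_bound\<close> is at least \<open>4 * Suc l\<close>, which exceeds the right side
    because \<open>exp \<epsilon> \<le> 3\<close>. The summand 4 secures
    \<open>4 \<le> B\<close>.\<close>
  define C where "C = nat \<lceil>4 / (1 - \<beta> - \<delta>)\<rceil> + 4"
  obtain f :: "nat \<Rightarrow> 'u" where f: "inj f"
    using infinite_countable_subset[OF assms(2)] by blast
  \<comment> \<open>The \<open>2 * l\<close> stages account for \<open>4 * l\<close>, the degree for
    \<open>Suc (C + l)\<close>.\<close>
  have bound: "log_star (real r) \<le> 5 * l + Suc C"
    if W: "privacy_wrapper \<epsilon> \<delta> W" "down_local l W" "interior_accurate r \<beta> l W"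
    for r l and W :: "'u randomized_alg"
  proof -
    define B where "B = C * Suc l"
    have "4 \<le> C" by (simp add: C_def)
    then have B: "4 \<le> B" by (simp add: B_def)
    have "r < level B (2 * l)"
    proof (rule ccontr)
      assume "\<not> r < level B (2 * l)"
      then interpret accurate_wrapper W l r B \<epsilon> \<delta> \<beta> "f \<circ> to_nat"
        using W B f by unfold_locales (auto intro: inj_compose)
      have "4 / (1 - \<beta> - \<delta>) \<le> real C" unfolding C_def by linarith
      then have "4 \<le> real C * (1 - \<beta> - \<delta>)" using assms by (simp add: pos_divide_le_eq)
      then have "4 * real (Suc l) \<le> real C * (1 - \<beta> - \<delta>) * real (Suc l)"
        by (rule mult_right_mono) simp
      also have "\<dots> = real B * (1 - \<beta> - \<delta>)" by (simp add: B_def algebra_simps)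
      also have "\<dots> \<le> exp \<epsilon> * real (Suc l) + real l" by (rule degree_bound)
      also have "exp \<epsilon> \<le> 3" using exp_le assms(4) exp_le_cancel_iff[of \<epsilon> 1] by linarith
      then have "exp \<epsilon> * real (Suc l) + real l \<le> 3 * real (Suc l) + real l"
        by (intro add_right_mono mult_right_mono) auto
      finally show False by simp
    qed
    then have "log_star (real r) \<le> log_star (real (level B (2 * l)))"
      by (intro log_star_mono) simp
    also have "\<dots> \<le> 2 * (2 * l) + log_star (real B)" by (rule log_star_level[OF B])
    also have "log_star (real B) \<le> Suc (C + l)"
      unfolding B_def using \<open>4 \<le> C\<close> by (intro log_star_mult_le) simp
    finally show ?thesis by simp
  qed
  \<comment> \<open>From here on the constant \<open>Suc C\<close> is at most half of
    \<open>log_star\<close>, which turns the factor \<open>1 / 5\<close> into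
    \<open>1 / 10\<close>.\<close>
  obtain x0 where x0: "\<And>x. x0 \<le> x \<Longrightarrow> 2 * Suc C \<le> log_star x"
    using log_star_unbounded[of "2 * Suc C"] by blast
  have "\<forall>\<^sub>F r in sequentially. \<forall>(W :: 'u randomized_alg) l.
           privacy_wrapper \<epsilon> \<delta> W \<longrightarrow> down_local l W \<longrightarrow> interior_accurate r \<beta> l W \<longrightarrow>
             real l \<ge> 1 / 10 * real (log_star (real r))"
    using eventually_ge_at_top[of "nat \<lceil>x0\<rceil>"]
  proof eventually_elim
    case (elim r)
    then have "2 * Suc C \<le> log_star (real r)" by (intro x0) linarith
    have "real l \<ge> 1 / 10 * real (log_star (real r))" if "log_star (real r) \<le> 5 * l + Suc C" for l
    proof -
      have "L \<le> 10 * l" if "2 * Suc C \<le> L" "L \<le> 5 * l + Suc C" for L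
        using that by presburger
      then have "log_star (real r) \<le> 10 * l"
        using that \<open>2 * Suc C \<le> log_star (real r)\<close> by blast
      then have "real (log_star (real r)) \<le> real (10 * l)" by (rule of_nat_mono)
      then show ?thesis by simp
    qed
    then show ?case using bound by blast
  qed
  then show ?thesis by (intro exI[of _ "1 / 10"]) simp
qed

end
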